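(* Let $m\ge 1$. (Direct part.) Let $D\subset\mathbb R^2$ be a simply connected open set with coordinates $(x,y)$, let $\varphi:D\to\mathbb R$ be a smooth function with $\sin\varphi\cos\varphi\neq 0$, and let $(\kappa^1,s^1),\dots,(\kappa^m,s^m)$ be arbitrary smooth solutions on $D$ of the linear system $$\kappa_x=\tan\varphi\; s_x,\qquad \kappa_y=-\cot\varphi\; s_y .$$ Let $U$ be the $2\times m$ matrix whose first row is $(\kappa^1,\dots,\kappa^m)$ and second row is $(s^1,\dots,s^m)$, let $V$ be a smooth $m\times m$ matrix function on $D$ satisfying $$dV=U^t\,dU,\qquad V+V^t=U^tU+E_m ,$$ assume $V$ is invertible on $D$, and let $$W=\begin{pmatrix}UV^{-1}\\ V^{-1}-E_m\end{pmatrix}$$ be the resulting $(m+2)\times m$ matrix, with columns ${\bf w}^1,\dots,{\bf w}^m$. Then for every $\gamma\in\{1,\dots,m\}$ for which ${\bf w}^\gamma$ is an immersion, ${\bf w}^\gamma$ is the radius-vector of a surface $M^2$ in the unit hypersphere $S^{m+1}\subset E^{m+2}$ with flat normal bundle, $x,y$ are coordinates of the lines of curvature of $M^2$, and the remaining $m-1$ columns ${\bf w}^\alpha$, $\alpha\ne\gamma$, are pairwise orthogonal unit normals of $M^2$ in $S^{m+1}$ which are parallel in the normal bundle. The metric $(d{\bf w}^\gamma,d{\bf w}^\gamma)$ and the second fundamental forms $(d{\bf w}^\gamma,d{\bf w}^\alpha)$, $\alpha\neq\gamma$, of $M^2$ are the corresponding entries of the matrix $$dW^t\,dW=(V^t)^{-1}\,dU^t\,dU\,V^{-1}.$$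 (Converse.) Let $M^2\subset S^{m+1}\subset E^{m+2}$ be a surface with flat normal bundle and let $p_0\in M^2$ be a point having a neighbourhood on which there are coordinates $x,y$ of the lines of curvature. Then, after a suitable choice of orthonormal coordinates in $E^{m+2}$, a neighbourhood of $p_0$ in $M^2$ is obtained by the construction of the direct part: there exist a smooth function $\varphi$ with $\sin\varphi\cos\varphi\neq0$, $m$ solutions $(\kappa^\alpha,s^\alpha)$, $\alpha=1,\dots,m$, of the linear system $\kappa_x=\tan\varphi\,s_x$, $\kappa_y=-\cot\varphi\,s_y$, and a smooth invertible $m\times m$ matrix function $V$ satisfying $dV=U^t\,dU$ and $V+V^t=U^tU+E_m$, where $U$ is the $2\times m$ matrix with rows $(\kappa^1,\dots,\kappa^m)$ and $(s^1,\dots,s^m)$, such that the radius-vector of $M^2$ near $p_0$ is a column of the corresponding matrix $W=\begin{pmatrix}UV^{-1}\\ V^{-1}-E_m\end{pmatrix}$ and the other columns of $W$ are parallel unit normals.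
   Context: $E^{N}$ is Euclidean $N$-space, $E_m$ is the $m\times m$ identity matrix, $t$ denotes transposition; $(\cdot,\cdot)$ is the Euclidean scalar product, and entries of $dU^t\,dU$ and $dW^t\,dW$ are understood as quadratic differential forms (symmetric products of 1-forms). All functions are smooth. A surface $M^2\subset S^{m+1}\subset E^{m+2}$ with radius-vector ${\bf r}$ has flat normal bundle if (locally) there exist $m-1$ pairwise orthogonal unit vector fields ${\bf n}^\alpha$ along $M^2$, orthogonal to ${\bf r}$ and to $TM^2$, with $d{\bf n}^\alpha\in TM^2$ for every $\alpha$; such normals are called parallel in the normal bundle. Coordinates $x,y$ on $M^2$ are coordinates of the lines of curvature if the metric $(d{\bf r},d{\bf r})$ and all second fundamental forms $(d{\bf r},d{\bf n}^\alpha)$ contain no $dx\,dy$ term; equivalently, ${\bf r}_x\perp{\bf r}_y$, and ${\bf n}^\alpha_x$ is proportional to ${\bf r}_x$ and ${\bf n}^\alpha_y$ is proportional to ${\bf r}_y$ for every $\alpha$. *)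

theory Defs
  imports "HOL-Analysis.Analysis"
begin

type_synonym plane = "real \<times> real"

text \<open>\<open>C\<^sup>k\<close> maps for finite \<open>k\<close>, by recursion over directional derivatives of the Frechet derivative;
  used for open \<open>S\<close> only.\<close>

primrec higher_differentiable_on ::
  "'a::real_normed_vector set \<Rightarrow> ('a \<Rightarrow> 'b::real_normed_vector) \<Rightarrow> nat \<Rightarrow> bool" where
  "higher_differentiable_on S f 0 \<longleftrightarrow> continuous_on S f"
| "higher_differentiable_on S f (Suc k) \<longleftrightarrow>
     (\<forall>p\<in>S. f differentiable (at p)) \<and>
     (\<forall>v. higher_differentiable_on S (\<lambda>p. frechet_derivative f (at p) v) k)"

definition smooth_on :: "'a::real_normed_vector set \<Rightarrow> ('a \<Rightarrow> 'b::real_normed_vector) \<Rightarrow> bool" where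
  "smooth_on S f \<longleftrightarrow> (\<forall>k. higher_differentiable_on S f k)"

definition pdx :: "(plane \<Rightarrow> 'b::real_normed_vector) \<Rightarrow> plane \<Rightarrow> 'b" where
  "pdx f p = frechet_derivative f (at p) (1, 0)"

definition pdy :: "(plane \<Rightarrow> 'b::real_normed_vector) \<Rightarrow> plane \<Rightarrow> 'b" where
  "pdy f p = frechet_derivative f (at p) (0, 1)"

text \<open>The quadratic differential form \<open>(df, dg)\<close> at \<open>p\<close>, as a function of the tangent vector
  \<open>v = (dx, dy)\<close>.\<close>

definition diff_form ::
  "(plane \<Rightarrow> 'e::real_inner) \<Rightarrow> (plane \<Rightarrow> 'e) \<Rightarrow> plane \<Rightarrow> plane \<Rightarrow> real" where
  "diff_form f g p v = frechet_derivative f (at p) v \<bullet> frechet_derivative g (at p) v"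

definition no_dxdy_term :: "(plane \<Rightarrow> real) \<Rightarrow> bool" where
  "no_dxdy_term Q \<longleftrightarrow> (\<exists>a b. \<forall>dx dy. Q (dx, dy) = a * dx\<^sup>2 + b * dy\<^sup>2)"

definition immersion_on :: "plane set \<Rightarrow> (plane \<Rightarrow> 'e::real_normed_vector) \<Rightarrow> bool" where
  "immersion_on D r \<longleftrightarrow> (\<forall>p\<in>D. inj (frechet_derivative r (at p)))"

definition tangent_plane :: "(plane \<Rightarrow> 'e::real_normed_vector) \<Rightarrow> plane \<Rightarrow> 'e set" where
  "tangent_plane r p = range (frechet_derivative r (at p))"

text \<open>\<open>r\<close> is the radius-vector of an (immersed) surface in the unit hypersphere.\<close>

definition surface_in_sphere :: "plane set \<Rightarrow> (plane \<Rightarrow> 'e::euclidean_space) \<Rightarrow> bool" where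
  "surface_in_sphere D r \<longleftrightarrow>
     open D \<and> smooth_on D r \<and> immersion_on D r \<and> r ` D \<subseteq> sphere 0 1"

text \<open>Pairwise orthogonal unit vector fields \<open>n i\<close>, \<open>i \<in> I\<close>, along the surface, orthogonal to the
  radius-vector and to the tangent plane, with all \<open>dn i\<close> tangent to the surface.\<close>

definition parallel_normals ::
  "plane set \<Rightarrow> (plane \<Rightarrow> 'e::euclidean_space) \<Rightarrow> 'i set \<Rightarrow> ('i \<Rightarrow> plane \<Rightarrow> 'e) \<Rightarrow> bool" where
  "parallel_normals D r I n \<longleftrightarrow>
     (\<forall>i\<in>I. smooth_on D (n i)) \<and>
     (\<forall>p\<in>D. \<forall>i\<in>I. \<forall>j\<in>I. n i p \<bullet> n j p = (if i = j then 1 else 0)) \<and>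
     (\<forall>p\<in>D. \<forall>i\<in>I. n i p \<bullet> r p = 0) \<and>
     (\<forall>p\<in>D. \<forall>i\<in>I. \<forall>t\<in>tangent_plane r p. n i p \<bullet> t = 0) \<and>
     (\<forall>p\<in>D. \<forall>i\<in>I. range (frechet_derivative (n i) (at p)) \<subseteq> tangent_plane r p)"

text \<open>In \<open>S\<^bsup>m+1\<^esup> \<subseteq> E\<^bsup>m+2\<^esup>\<close> the number of normals is \<open>m - 1 = DIM('e) - 3\<close>.\<close>

definition has_flat_normal_bundle :: "plane set \<Rightarrow> (plane \<Rightarrow> 'e::euclidean_space) \<Rightarrow> bool" where
  "has_flat_normal_bundle D r \<longleftrightarrow>
     (\<forall>p\<in>D. \<exists>N n. open N \<and> p \<in> N \<and> N \<subseteq> D \<and> parallel_normals N r {..<DIM('e) - 3} n)"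

definition curvature_line_coordinates :: "plane set \<Rightarrow> (plane \<Rightarrow> 'e::euclidean_space) \<Rightarrow> bool" where
  "curvature_line_coordinates D r \<longleftrightarrow>
     (\<forall>p\<in>D. no_dxdy_term (diff_form r r p)) \<and>
     (\<forall>N n. open N \<and> N \<subseteq> D \<and> parallel_normals N r {..<DIM('e) - 3} n \<longrightarrow>
        (\<forall>p\<in>N. \<forall>i<DIM('e) - 3. no_dxdy_term (diff_form r (n i) p)))"

text \<open>Surfaces as subsets of Euclidean space (embedded two-dimensional submanifolds), through their
  local parametrizations. The condition in \<open>has_flat_normal_bundle\<close> is local and invariant under
  changes of coordinates, so it is imposed in all local parametrizations.\<close>

definition local_parametrization ::
  "'e::euclidean_space set \<Rightarrow> plane set \<Rightarrow> (plane \<Rightarrow> 'e) \<Rightarrow> bool" where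
  "local_parametrization M D r \<longleftrightarrow>
     open D \<and> smooth_on D r \<and> immersion_on D r \<and>
     openin (top_of_set M) (r ` D) \<and> (\<exists>g. homeomorphism D (r ` D) r g)"

definition smooth_surface :: "'e::euclidean_space set \<Rightarrow> bool" where
  "smooth_surface M \<longleftrightarrow> (\<forall>p\<in>M. \<exists>D r. local_parametrization M D r \<and> p \<in> r ` D)"

definition flat_normal_bundle :: "'e::euclidean_space set \<Rightarrow> bool" where
  "flat_normal_bundle M \<longleftrightarrow>
     (\<forall>D r. local_parametrization M D r \<longrightarrow> has_flat_normal_bundle D r)"

definition U_matrix ::
  "('m::finite \<Rightarrow> plane \<Rightarrow> real) \<Rightarrow> ('m \<Rightarrow> plane \<Rightarrow> real) \<Rightarrow> plane \<Rightarrow> real^'m^2" where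
  "U_matrix \<kappa> s p = (\<chi> i \<alpha>. if i = 1 then \<kappa> \<alpha> p else s \<alpha> p)"

definition W_matrix ::
  "(plane \<Rightarrow> real^'m^2) \<Rightarrow> (plane \<Rightarrow> real^'m^'m) \<Rightarrow> plane \<Rightarrow> real^'m^(2 + 'm::finite)" where
  "W_matrix U V p =
     (\<chi> i. case i of
        Inl a \<Rightarrow> (U p ** matrix_inv (V p)) $ a
      | Inr b \<Rightarrow> (matrix_inv (V p) - mat 1) $ b)"

definition W_column ::
  "(plane \<Rightarrow> real^'m^2) \<Rightarrow> (plane \<Rightarrow> real^'m^'m) \<Rightarrow> 'm::finite \<Rightarrow> plane \<Rightarrow> real^(2 + 'm)" where
  "W_column U V \<alpha> p = column \<alpha> (W_matrix U V p)"

definition construction_data ::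
  "plane set \<Rightarrow> (plane \<Rightarrow> real) \<Rightarrow> ('m::finite \<Rightarrow> plane \<Rightarrow> real) \<Rightarrow> ('m \<Rightarrow> plane \<Rightarrow> real) \<Rightarrow>
    (plane \<Rightarrow> real^'m^'m) \<Rightarrow> bool" where
  "construction_data D \<phi> \<kappa> s V \<longleftrightarrow>
     open D \<and> simply_connected D \<and>
     smooth_on D \<phi> \<and> (\<forall>p\<in>D. sin (\<phi> p) * cos (\<phi> p) \<noteq> 0) \<and>
     (\<forall>\<alpha>. smooth_on D (\<kappa> \<alpha>) \<and> smooth_on D (s \<alpha>)) \<and>
     (\<forall>\<alpha>. \<forall>p\<in>D. pdx (\<kappa> \<alpha>) p = tan (\<phi> p) * pdx (s \<alpha>) p \<and>
                pdy (\<kappa> \<alpha>) p = - cot (\<phi> p) * pdy (s \<alpha>) p) \<and>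
     smooth_on D V \<and>
     (\<forall>p\<in>D. \<forall>v. frechet_derivative V (at p) v =
        transpose (U_matrix \<kappa> s p) ** frechet_derivative (U_matrix \<kappa> s) (at p) v) \<and>
     (\<forall>p\<in>D. V p + transpose (V p) = transpose (U_matrix \<kappa> s p) ** U_matrix \<kappa> s p + mat 1) \<and>
     (\<forall>p\<in>D. invertible (V p))"

end

theory Submission
  imports Defs
begin

text \<open>
  With \<open>Z = V\<^sup>-\<^sup>1\<close> the relation \<open>V + V\<^sup>t = U\<^sup>tU + 1\<close> says that the columns of \<open>W\<close> are orthonormal, and
  \<open>dV = U\<^sup>t dU\<close> gives \<open>dW = A dU Z\<close> with \<open>A\<close> an isometric embedding of the plane orthogonal to the
  columns. The linear system makes \<open>U\<^sub>x\<close> and \<open>U\<^sub>y\<close> matrices of rank one with orthogonal directions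
  \<open>(sin \<phi>, cos \<phi>)\<close> and \<open>(cos \<phi>, - sin \<phi>)\<close>, so all columns have proportional \<open>x\<close>- and proportional
  \<open>y\<close>-derivatives.

  Conversely, collect the radius-vector and the parallel normals in a matrix \<open>W\<close> with blocks \<open>T\<close> and
  \<open>B\<close>, after a rotation making \<open>T = 0\<close> and \<open>B = 1\<close> at the given point. Near it \<open>B + 1\<close> is invertible,
  and \<open>V = (B + 1)\<^sup>-\<^sup>1\<close>, \<open>U = T V\<close> satisfy the same identities read backwards. The plane part of the
  rotation is free and is used to keep \<open>\<phi>\<close> away from the zeros of sine and cosine.
\<close>

subsection \<open>Calculus of smooth maps\<close>

text \<open>On an open set a derivative depends only on nearby values, so equality on
  \<open>S\<close> passes to all directional derivatives. The step replaces \<open>f\<close> and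
  \<open>g\<close> by these, hence both are generalised.\<close>

lemma higher_differentiable_on_cong:
  assumes "open S" "\<And>p. p \<in> S \<Longrightarrow> f p = g p" "higher_differentiable_on S f k"
  shows "higher_differentiable_on S g k"
  using assms(2,3)
proof (induction k arbitrary: f g)
  case 0
  then show ?case by (simp cong: continuous_on_cong)
next
  case (Suc k)
  have D: "(g has_derivative frechet_derivative f (at p)) (at p)" if "p \<in> S" for p
    using Suc.prems that assms(1)
    by (metis frechet_derivative_works has_derivative_transform_within_open higher_differentiable_on.simps(2))
  then have "frechet_derivative g (at p) = frechet_derivative f (at p)" if "p \<in> S" for p
    using that frechet_derivative_at by metis
  with Suc.IH[of "\<lambda>p. frechet_derivative f (at p) v" "\<lambda>p. frechet_derivative g (at p) v" for v]
    Suc.prems(2) D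
  show ?case by (auto simp: differentiable_def)
qed

lemma higher_differentiable_on_subset:
  "\<lbrakk>higher_differentiable_on S f k; T \<subseteq> S\<rbrakk> \<Longrightarrow> higher_differentiable_on T f k"
  by (induction k arbitrary: f) (auto intro: continuous_on_subset)

text \<open>The recursion mentions continuity only at order \<open>0\<close>; differentiability
  supplies it there, and the induction passes through the derivatives.\<close>

lemma higher_differentiable_on_SucD:
  "higher_differentiable_on S f (Suc k) \<Longrightarrow> higher_differentiable_on S f k"
proof (induction k arbitrary: f)
  case 0
  then show ?case
    by (auto intro!: continuous_at_imp_continuous_on differentiable_imp_continuous_within)
next
  case (Suc k)
  then show ?case by (metis higher_differentiable_on.simps(2))
qed

text \<open>Allows any explicitly computed derivative in place of the chosen
  \<open>frechet_derivative\<close>, so that the closure properties below can use the ordinary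
  differentiation rules.\<close>

lemma higher_differentiable_on_SucI:
  assumes "open S" and D: "\<And>p. p \<in> S \<Longrightarrow> (f has_derivative f' p) (at p)"
    and "\<And>v. higher_differentiable_on S (\<lambda>p. f' p v) k"
  shows "higher_differentiable_on S f (Suc k)"
proof -
  have "f' p = frechet_derivative f (at p)" if "p \<in> S" for p
    using D[OF that] frechet_derivative_at by blast
  then show ?thesis
    using assms by (auto simp: differentiable_def intro!: higher_differentiable_on_cong[OF assms(1) _ assms(3)])
qed

lemma higher_differentiable_on_const: "higher_differentiable_on S (\<lambda>_. c) k"
  by (induction k arbitrary: c) auto

lemma higher_differentiable_on_has_derivative:
  "\<lbrakk>higher_differentiable_on S f (Suc k); p \<in> S\<rbrakk> \<Longrightarrow>
    (f has_derivative frechet_derivative f (at p)) (at p)"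
  by (simp add: frechet_derivative_works[symmetric])

lemma higher_differentiable_on_linear:
  assumes "open S" "bounded_linear h" "higher_differentiable_on S f k"
  shows "higher_differentiable_on S (\<lambda>p. h (f p)) k"
  using assms(3)
proof (induction k arbitrary: f)
  case 0
  then show ?case using assms(2) by (simp add: bounded_linear.continuous_on)
next
  case (Suc k)
  show ?case
    by (rule higher_differentiable_on_SucI[OF assms(1)],
        rule bounded_linear.has_derivative[OF assms(2) higher_differentiable_on_has_derivative[OF Suc.prems]])
      (use Suc in auto)
qed

lemma higher_differentiable_on_add:
  assumes "open S" "higher_differentiable_on S f k" "higher_differentiable_on S g k"
  shows "higher_differentiable_on S (\<lambda>p. f p + g p) k"
  using assms(2,3)
proof (induction k arbitrary: f g)
  case 0
  then show ?case by (simp add: continuous_on_add)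
next
  case (Suc k)
  show ?case
    by (rule higher_differentiable_on_SucI[OF assms(1)],
        rule has_derivative_add[OF higher_differentiable_on_has_derivative[OF Suc.prems(1)]
          higher_differentiable_on_has_derivative[OF Suc.prems(2)]])
      (use Suc in auto)
qed

text \<open>By the product rule a derivative is a sum of two values of \<open>h\<close>, each with
  one factor differentiated. The other factor is lowered to order \<open>k\<close>, so the induction
  hypothesis covers both summands.\<close>

lemma higher_differentiable_on_bilinear:
  assumes "open S" "bounded_bilinear h"
    "higher_differentiable_on S f k" "higher_differentiable_on S g k"
  shows "higher_differentiable_on S (\<lambda>p. h (f p) (g p)) k"
  using assms(3,4)
proof (induction k arbitrary: f g)
  case 0
  then show ?case by (simp add: bounded_bilinear.continuous_on[OF assms(2)])
next
  case (Suc k)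
  show ?case
  proof (rule higher_differentiable_on_SucI[OF assms(1)])
    show "((\<lambda>p. h (f p) (g p)) has_derivative
        (\<lambda>v. h (f p) (frechet_derivative g (at p) v) + h (frechet_derivative f (at p) v) (g p))) (at p)"
      if "p \<in> S" for p
      by (rule bounded_bilinear.FDERIV[OF assms(2)])
        (use Suc.prems that higher_differentiable_on_has_derivative in blast)+
    show "higher_differentiable_on S (\<lambda>p. h (f p) (frechet_derivative g (at p) v)
        + h (frechet_derivative f (at p) v) (g p)) k" for v
      using Suc.prems higher_differentiable_on_SucD[OF Suc.prems(1)]
        higher_differentiable_on_SucD[OF Suc.prems(2)]
      by (intro higher_differentiable_on_add[OF assms(1)] Suc.IH) auto
  qed
qed

text \<open>The derivative of the reciprocal is built from the reciprocal itself and a derivative of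
  \<open>f\<close>, so its order rises one step at a time with \<open>f\<close> fixed.\<close>

lemma higher_differentiable_on_inverse:
  fixes f :: "'a::real_normed_vector \<Rightarrow> real"
  assumes "open S" "\<And>p. p \<in> S \<Longrightarrow> f p \<noteq> 0" "higher_differentiable_on S f k"
  shows "higher_differentiable_on S (\<lambda>p. inverse (f p)) k"
  using assms(3)
proof (induction k)
  case 0
  then show ?case using assms(2) by (simp add: continuous_on_inverse)
next
  case (Suc k)
  note k = Suc.IH[OF higher_differentiable_on_SucD[OF Suc.prems]]
  show ?case
  proof (rule higher_differentiable_on_SucI[OF assms(1)])
    show "((\<lambda>p. inverse (f p)) has_derivative
        (\<lambda>v. - (inverse (f p) * frechet_derivative f (at p) v * inverse (f p)))) (at p)"
      if "p \<in> S" for p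
      by (rule Deriv.has_derivative_inverse)
        (use assms(2) Suc.prems that higher_differentiable_on_has_derivative in blast)+
    have "higher_differentiable_on S (\<lambda>p. inverse (f p) * frechet_derivative f (at p) v * inverse (f p)) k" for v
      using Suc.prems
      by (intro higher_differentiable_on_bilinear[OF assms(1) bounded_bilinear_mult] k) auto
    from higher_differentiable_on_linear[OF assms(1) bounded_linear_minus[OF bounded_linear_ident] this]
    show "higher_differentiable_on S
        (\<lambda>p. - (inverse (f p) * frechet_derivative f (at p) v * inverse (f p))) k" for v .
  qed
qed

text \<open>After one differentiation the arctangent is gone and the rules for products and
  reciprocals finish, so a case distinction replaces induction.\<close>

lemma higher_differentiable_on_arctan:
  assumes "open S" "higher_differentiable_on S f k"
  shows "higher_differentiable_on S (\<lambda>p. arctan (f p)) k"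
proof (cases k)
  case 0
  then show ?thesis using assms(2) by (simp add: continuous_on_arctan)
next
  case (Suc j)
  note f = assms(2)[unfolded Suc]
  show ?thesis unfolding Suc
  proof (rule higher_differentiable_on_SucI[OF assms(1)])
    show "((\<lambda>p. arctan (f p)) has_derivative
        (\<lambda>v. frechet_derivative f (at p) v * inverse (1 + f p * f p))) (at p)" if "p \<in> S" for p
      by (rule derivative_eq_intros higher_differentiable_on_has_derivative[OF f that] refl)+
        (simp add: power2_eq_square)
    have "1 + f p * f p \<noteq> 0" for p
      by (metis add_pos_nonneg less_irrefl zero_le_square zero_less_one)
    then show "higher_differentiable_on S
        (\<lambda>p. frechet_derivative f (at p) v * inverse (1 + f p * f p)) j" for v
      using f higher_differentiable_on_SucD[OF f]
      by (intro higher_differentiable_on_bilinear[OF assms(1) bounded_bilinear_mult]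
          higher_differentiable_on_inverse[OF assms(1)] higher_differentiable_on_add[OF assms(1)]
          higher_differentiable_on_const) auto
  qed
qed

section \<open>Closure properties of smooth maps\<close>

lemma smooth_on_cong:
  "\<lbrakk>open S; \<And>p. p \<in> S \<Longrightarrow> f p = g p; smooth_on S f\<rbrakk> \<Longrightarrow> smooth_on S g"
  unfolding smooth_on_def using higher_differentiable_on_cong by blast

lemma smooth_on_subset: "\<lbrakk>smooth_on S f; T \<subseteq> S\<rbrakk> \<Longrightarrow> smooth_on T f"
  unfolding smooth_on_def using higher_differentiable_on_subset by blast

lemma smooth_on_const: "smooth_on S (\<lambda>_. c)"
  unfolding smooth_on_def using higher_differentiable_on_const by blast

lemma smooth_on_linear:
  "\<lbrakk>open S; bounded_linear h; smooth_on S f\<rbrakk> \<Longrightarrow> smooth_on S (\<lambda>p. h (f p))"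
  unfolding smooth_on_def using higher_differentiable_on_linear by blast

lemma smooth_on_add: "\<lbrakk>open S; smooth_on S f; smooth_on S g\<rbrakk> \<Longrightarrow> smooth_on S (\<lambda>p. f p + g p)"
  unfolding smooth_on_def using higher_differentiable_on_add by blast

lemma smooth_on_bilinear:
  "\<lbrakk>open S; bounded_bilinear h; smooth_on S f; smooth_on S g\<rbrakk> \<Longrightarrow> smooth_on S (\<lambda>p. h (f p) (g p))"
  unfolding smooth_on_def using higher_differentiable_on_bilinear by blast

lemmas smooth_on_mult = smooth_on_bilinear[OF _ bounded_bilinear_mult]

lemma smooth_on_diff:
  assumes "open S" "smooth_on S f" "smooth_on S g"
  shows "smooth_on S (\<lambda>p. f p - g p)"
  using smooth_on_add[OF assms(1,2)
      smooth_on_linear[OF assms(1) bounded_linear_minus[OF bounded_linear_ident] assms(3)]]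
  by simp

lemma smooth_on_inverse:
  fixes f :: "'a::real_normed_vector \<Rightarrow> real"
  shows "\<lbrakk>open S; \<And>p. p \<in> S \<Longrightarrow> f p \<noteq> 0; smooth_on S f\<rbrakk> \<Longrightarrow> smooth_on S (\<lambda>p. inverse (f p))"
  unfolding smooth_on_def using higher_differentiable_on_inverse by blast

lemma smooth_on_arctan: "\<lbrakk>open S; smooth_on S f\<rbrakk> \<Longrightarrow> smooth_on S (\<lambda>p. arctan (f p))"
  unfolding smooth_on_def using higher_differentiable_on_arctan by blast

lemma smooth_on_sum:
  assumes "open S" "\<And>i. i \<in> I \<Longrightarrow> smooth_on S (f i)"
  shows "smooth_on S (\<lambda>p. \<Sum>i\<in>I. f i p)"
  using assms(2)
  by (induction I rule: infinite_finite_induct)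
    (auto intro: smooth_on_const smooth_on_add[OF assms(1)])

lemma smooth_on_prod:
  fixes f :: "'i \<Rightarrow> 'a::real_normed_vector \<Rightarrow> real"
  assumes "open S" "\<And>i. i \<in> I \<Longrightarrow> smooth_on S (f i)"
  shows "smooth_on S (\<lambda>p. \<Prod>i\<in>I. f i p)"
  using assms(2)
  by (induction I rule: infinite_finite_induct)
    (auto intro: smooth_on_const smooth_on_mult[OF assms(1)])

lemma smooth_on_vec_lambda:
  fixes f :: "'i::finite \<Rightarrow> 'a::real_normed_vector \<Rightarrow> 'b::euclidean_space"
  assumes "open S" "\<And>i. smooth_on S (f i)"
  shows "smooth_on S (\<lambda>p. \<chi> i. f i p)"
proof -
  \<comment> \<open>The vector is a sum of its coordinates put in their positions, and each such
    placement is linear.\<close>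
  have lin: "linear (\<lambda>c. \<chi> j. if j = i then c else 0)" for i :: 'i
    by (rule linearI) (auto simp: vec_eq_iff)
  have "smooth_on S (\<lambda>p. \<Sum>i\<in>UNIV. \<chi> j. if j = i then f i p else 0)"
    using assms
    by (intro smooth_on_sum smooth_on_linear[OF assms(1) linear_conv_bounded_linear[THEN iffD1, OF lin]]) auto
  moreover have "(\<Sum>i\<in>UNIV. \<chi> j. if j = i then f i p else 0) = (\<chi> i. f i p)" for p
    by (simp add: vec_eq_iff)
  ultimately show ?thesis by simp
qed

lemma smooth_on_frechet_derivative:
  "smooth_on S f \<Longrightarrow> smooth_on S (\<lambda>p. frechet_derivative f (at p) v)"
  unfolding smooth_on_def by (metis higher_differentiable_on.simps(2))

lemma smooth_on_has_derivative:
  "\<lbrakk>smooth_on S f; p \<in> S\<rbrakk> \<Longrightarrow> (f has_derivative frechet_derivative f (at p)) (at p)"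
  unfolding smooth_on_def using higher_differentiable_on_has_derivative by blast

lemma smooth_on_continuous_on: "smooth_on S f \<Longrightarrow> continuous_on S f"
  unfolding smooth_on_def by (metis higher_differentiable_on.simps(1))

section \<open>Smooth matrix functions and the derivative of the inverse\<close>

lemma smooth_on_det:
  fixes A :: "'a::real_normed_vector \<Rightarrow> real^'n^'n"
  assumes "open S" "\<And>i j. smooth_on S (\<lambda>p. A p $ i $ j)"
  shows "smooth_on S (\<lambda>p. det (A p))"
  unfolding det_def
  by (intro smooth_on_sum smooth_on_mult smooth_on_const smooth_on_prod assms)

lemma smooth_on_component: "\<lbrakk>open S; smooth_on S f\<rbrakk> \<Longrightarrow> smooth_on S (\<lambda>p. f p $ i)"
  by (rule smooth_on_linear[OF _ bounded_linear_vec_nth])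

lemma matrix_inv_mult:
  fixes A :: "real^'n^'n"
  assumes "invertible A"
  shows "A ** matrix_inv A = mat 1" "matrix_inv A ** A = mat 1"
  using someI_ex[OF assms[unfolded invertible_def]] by (auto simp: matrix_inv_def)

text \<open>Smoothness of the entries of the inverse is read off Cramer's rule.\<close>

lemma smooth_on_matrix_inv:
  fixes A :: "'a::real_normed_vector \<Rightarrow> real^'n^'n"
  assumes "open S" "smooth_on S A" "\<And>p. p \<in> S \<Longrightarrow> invertible (A p)"
  shows "smooth_on S (\<lambda>p. matrix_inv (A p))"
proof -
  have A: "smooth_on S (\<lambda>p. A p $ i $ j)" for i j
    by (intro smooth_on_component assms)
  have det: "det (A p) \<noteq> 0" if "p \<in> S" for p
    using assms(3)[OF that] by (simp add: invertible_det_nz)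
  have eq: "det (\<chi> i j. if j = k then axis l 1 $ i else A p $ i $ j) * inverse (det (A p))
      = matrix_inv (A p) $ k $ l" if "p \<in> S" for p k l
  proof -
    \<comment> \<open>Column \<open>l\<close> of the inverse solves the linear system with
      right-hand side \<open>axis l 1\<close>; Cramer's rule gives its entry
      \<open>k\<close>.\<close>
    have "A p *v (matrix_inv (A p) *v axis l 1) = axis l 1"
      using matrix_inv_mult[OF assms(3)[OF that]] by (simp add: matrix_vector_mul_assoc)
    then have "matrix_inv (A p) *v axis l 1
        = (\<chi> k. det (\<chi> i j. if j = k then axis l 1 $ i else A p $ i $ j) / det (A p))"
      using cramer[OF det[OF that]] by blast
    moreover have "matrix_inv (A p) $ k $ l = (matrix_inv (A p) *v axis l 1) $ k"
      by (simp add: matrix_vector_mult_basis column_def)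
    ultimately show ?thesis by (simp add: field_simps)
  qed
  have num: "smooth_on S (\<lambda>p. det (\<chi> i j. if j = k then axis l 1 $ i else A p $ i $ j))" for k l
  proof (rule smooth_on_det[OF assms(1)])
    show "smooth_on S (\<lambda>p. (\<chi> i j. if j = k then axis l 1 $ i else A p $ i $ j) $ i $ j)" for i j
      by (cases "j = k") (simp_all add: smooth_on_const A)
  qed
  have "smooth_on S (\<lambda>p. matrix_inv (A p) $ k $ l)" for k l
    by (rule smooth_on_cong[OF assms(1) eq smooth_on_mult[OF assms(1) num smooth_on_inverse[OF assms(1) det]]])
      (use smooth_on_det[OF assms(1) A] in auto)
  then have "smooth_on S (\<lambda>p. \<chi> k l. matrix_inv (A p) $ k $ l)"
    by (intro smooth_on_vec_lambda assms(1))
  then show ?thesis by simp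
qed

lemma bounded_bilinear_matrix_mult:
  "bounded_bilinear (\<lambda>(A::real^'n^'m) (B::real^'k^'n). A ** B)"
proof -
  have "bilinear (\<lambda>(A::real^'n^'m) (B::real^'k^'n). A ** B)"
    unfolding bilinear_def
    by (auto intro!: linearI
        simp: matrix_matrix_mult_def vec_eq_iff algebra_simps sum.distrib sum_distrib_left)
  then show ?thesis by (simp add: bilinear_conv_bounded_bilinear)
qed

lemmas smooth_on_matrix_mult = smooth_on_bilinear[OF _ bounded_bilinear_matrix_mult]

lemma frechet_derivative_eqI:
  "(f has_derivative f') (at p) \<Longrightarrow> frechet_derivative f (at p) = f'"
  using frechet_derivative_at by metis

text \<open>The inverse is already known to be smooth, so its derivative only has to be identified:
  differentiate \<open>A p ** matrix_inv (A p) = mat 1\<close> and multiply by the inverse from the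
  left.\<close>

lemma has_derivative_matrix_inv:
  fixes A :: "'a::real_normed_vector \<Rightarrow> real^'n^'n"
  assumes "open S" "smooth_on S A" "\<And>p. p \<in> S \<Longrightarrow> invertible (A p)" "p \<in> S"
  shows "((\<lambda>p. matrix_inv (A p)) has_derivative
    (\<lambda>v. - (matrix_inv (A p) ** frechet_derivative A (at p) v ** matrix_inv (A p)))) (at p)"
proof -
  let ?Z = "\<lambda>p. matrix_inv (A p)"
  let ?Z' = "frechet_derivative ?Z (at p)"
  have Z: "(?Z has_derivative ?Z') (at p)"
    by (rule smooth_on_has_derivative[OF smooth_on_matrix_inv[OF assms(1-3)] assms(4)])
  have "((\<lambda>p. A p ** ?Z p) has_derivative
      (\<lambda>v. A p ** ?Z' v + frechet_derivative A (at p) v ** ?Z p)) (at p)"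
    by (rule bounded_bilinear.FDERIV[OF bounded_bilinear_matrix_mult
          smooth_on_has_derivative[OF assms(2,4)] Z])
  moreover have "((\<lambda>p. A p ** ?Z p) has_derivative (\<lambda>v. 0)) (at p)"
    by (rule has_derivative_transform_within_open[OF has_derivative_const assms(1,4)])
      (simp add: matrix_inv_mult assms(3))
  ultimately have "(\<lambda>v. A p ** ?Z' v + frechet_derivative A (at p) v ** ?Z p) = (\<lambda>v. 0)"
    by (rule has_derivative_unique)
  from fun_cong[OF this] have "A p ** ?Z' v + frechet_derivative A (at p) v ** ?Z p = 0" for v .
  then have *: "A p ** ?Z' v = - (frechet_derivative A (at p) v ** ?Z p)" for v
    by (simp add: eq_neg_iff_add_eq_0)
  have "?Z' v = - (?Z p ** frechet_derivative A (at p) v ** ?Z p)" for v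
  proof -
    have "?Z' v = ?Z p ** (A p ** ?Z' v)"
      by (simp add: matrix_mul_assoc matrix_inv_mult assms)
    then show ?thesis
      unfolding *
      by (simp add: matrix_mul_assoc bounded_bilinear.minus_right[OF bounded_bilinear_matrix_mult])
  qed
  then have "?Z' = (\<lambda>v. - (?Z p ** frechet_derivative A (at p) v ** ?Z p))" by blast
  with Z show ?thesis by simp
qed

section \<open>Symmetry of second derivatives\<close>

lemma second_difference_mean_value:
  fixes f :: "'a::real_normed_vector \<Rightarrow> real"
  assumes "smooth_on S f" "h > 0"
    and S: "\<And>s t. \<lbrakk>0 \<le> s; s \<le> h; 0 \<le> t; t \<le> h\<rbrakk> \<Longrightarrow> p + s *\<^sub>R u + t *\<^sub>R v \<in> S"
  shows "\<exists>s t. 0 \<le> s \<and> s \<le> h \<and> 0 \<le> t \<and> t \<le> h \<and>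
    f (p + h *\<^sub>R u + h *\<^sub>R v) - f (p + h *\<^sub>R u) - f (p + h *\<^sub>R v) + f p =
    h\<^sup>2 * frechet_derivative (\<lambda>q. frechet_derivative f (at q) u) (at (p + s *\<^sub>R u + t *\<^sub>R v)) v"
proof -
  let ?D = "\<lambda>f q. frechet_derivative f (at q)"
  have line: "((\<lambda>t. g (q + t *\<^sub>R w)) has_real_derivative ?D g (q + t *\<^sub>R w) w) (at t)"
    if "smooth_on S g" "q + t *\<^sub>R w \<in> S" for g :: "'a \<Rightarrow> real" and q w t
  proof -
    have g: "(g has_derivative ?D g (q + t *\<^sub>R w)) (at (q + t *\<^sub>R w))"
      by (rule smooth_on_has_derivative[OF that])
    have "((\<lambda>t. g (q + t *\<^sub>R w)) has_derivative (\<lambda>x. ?D g (q + t *\<^sub>R w) (x *\<^sub>R w))) (at t)"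
      by (rule has_derivative_compose[where f = "\<lambda>t. q + t *\<^sub>R w", OF _ g]) (auto intro!: derivative_eq_intros)
    then show ?thesis
      using has_derivative_linear[OF g]
      by (simp add: has_field_derivative_def linear_cmul mult_commute_abs)
  qed
  \<comment> \<open>The second difference is the increment of \<open>g\<close> along
    \<open>u\<close>. The mean value theorem turns it into \<open>h\<close> times an increment of
    \<open>k\<close> along \<open>v\<close>, and a second use yields the mixed derivative.\<close>
  define g where "g s = f (p + h *\<^sub>R v + s *\<^sub>R u) - f (p + s *\<^sub>R u)" for s
  have g': "(g has_real_derivative (?D f (p + h *\<^sub>R v + s *\<^sub>R u) u - ?D f (p + s *\<^sub>R u) u)) (at s)"
    if "0 \<le> s" "s \<le> h" for s
    unfolding g_def
    using S[OF that, of h] S[OF that, of 0] assms(2)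
    by (intro DERIV_diff line[OF assms(1)]) (auto simp: algebra_simps)
  obtain s where s: "0 < s" "s < h"
    "g h - g 0 = h * (?D f (p + h *\<^sub>R v + s *\<^sub>R u) u - ?D f (p + s *\<^sub>R u) u)"
    using MVT2[OF assms(2) g'] by auto
  define k where "k t = ?D f (p + s *\<^sub>R u + t *\<^sub>R v) u" for t
  have k': "(k has_real_derivative ?D (\<lambda>q. ?D f q u) (p + s *\<^sub>R u + t *\<^sub>R v) v) (at t)"
    if "0 \<le> t" "t \<le> h" for t
    unfolding k_def using s S[OF _ _ that, of s]
    by (intro line[OF smooth_on_frechet_derivative[OF assms(1)]]) auto
  obtain t where t: "0 < t" "t < h" "k h - k 0 = h * ?D (\<lambda>q. ?D f q u) (p + s *\<^sub>R u + t *\<^sub>R v) v"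
    using MVT2[OF assms(2) k'] by auto
  have "f (p + h *\<^sub>R u + h *\<^sub>R v) - f (p + h *\<^sub>R u) - f (p + h *\<^sub>R v) + f p = g h - g 0"
    by (simp add: g_def algebra_simps)
  also have "\<dots> = h * (k h - k 0)"
    by (simp add: s k_def algebra_simps)
  finally show ?thesis
    using s t by (intro exI[of _ s] exI[of _ t]) (simp add: power2_eq_square)
qed

lemma frechet_derivative_linear:
  assumes "bounded_linear h" "smooth_on S f" "p \<in> S"
  shows "frechet_derivative (\<lambda>q. h (f q)) (at p) v = h (frechet_derivative f (at p) v)"
  using frechet_derivative_eqI[OF bounded_linear.has_derivative[OF assms(1)
        smooth_on_has_derivative[OF assms(2,3)]]] by simp

text \<open>The second difference over a small parallelogram is symmetric in \<open>u\<close> and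
  \<open>v\<close>. It is \<open>h\<^sup>2\<close> times either mixed derivative at some nearby
  point, and both are continuous at \<open>p\<close>.\<close>

lemma mixed_derivatives_commute_real:
  fixes f :: "'a::real_normed_vector \<Rightarrow> real"
  assumes "open S" "smooth_on S f" "p \<in> S"
  shows "frechet_derivative (\<lambda>q. frechet_derivative f (at q) u) (at p) v =
    frechet_derivative (\<lambda>q. frechet_derivative f (at q) v) (at p) u"
proof -
  let ?D = "\<lambda>f q. frechet_derivative f (at q)"
  define F where "F u v q = ?D (\<lambda>q. ?D f q u) q v" for u v q
  have cont: "isCont (F u v) p" for u v
    unfolding F_def
    using assms smooth_on_continuous_on[OF smooth_on_frechet_derivative[OF smooth_on_frechet_derivative[OF assms(2)]]]
    by (simp add: continuous_on_eq_continuous_at)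
  have "\<bar>F u v p - F v u p\<bar> \<le> e" if "e > 0" for e
  proof -
    obtain d1 where d1: "d1 > 0" "ball p d1 \<subseteq> S"
      using assms openE by blast
    obtain d2 where d2: "d2 > 0" "\<And>q. dist q p < d2 \<Longrightarrow> dist (F u v q) (F u v p) < e / 2"
      using cont[of u v] \<open>e > 0\<close> unfolding continuous_at_eps_delta by (metis half_gt_zero)
    obtain d3 where d3: "d3 > 0" "\<And>q. dist q p < d3 \<Longrightarrow> dist (F v u q) (F v u p) < e / 2"
      using cont[of v u] \<open>e > 0\<close> unfolding continuous_at_eps_delta by (metis half_gt_zero)
    define d where "d = min d1 (min d2 d3)"
    \<comment> \<open>This size keeps the parallelogram within distance \<open>d\<close> of
      \<open>p\<close>; the summand \<open>1\<close> keeps the denominator positive when both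
      directions vanish.\<close>
    define h where "h = d / (2 * (1 + norm u + norm v))"
    have "d > 0" using d1 d2 d3 by (simp add: d_def)
    then have "h > 0" by (simp add: h_def add_pos_nonneg)
    have pos: "1 + norm u + norm v > 0" by (simp add: add_pos_nonneg)
    have near: "dist (p + s *\<^sub>R x + t *\<^sub>R y) p < d"
      if "0 \<le> s" "s \<le> h" "0 \<le> t" "t \<le> h" "{x, y} = {u, v}" for s t x y
    proof -
      have "dist (p + s *\<^sub>R x + t *\<^sub>R y) p \<le> norm (s *\<^sub>R x) + norm (t *\<^sub>R y)"
        using norm_triangle_ineq[of "s *\<^sub>R x" "t *\<^sub>R y"] by (simp add: dist_norm add.assoc)
      also have "\<dots> \<le> h * norm x + h * norm y"
        using that by (intro add_mono) (auto intro: mult_right_mono)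
      also have "\<dots> = h * (norm u + norm v)"
        using that(5) by (auto simp: doubleton_eq_iff algebra_simps)
      also have "\<dots> < 2 * h * (1 + norm u + norm v)"
      proof -
        have "0 \<le> h * norm u" "0 \<le> h * norm v" using \<open>h > 0\<close> by auto
        moreover have "2 * h * (1 + norm u + norm v) = 2 * h + 2 * (h * norm u) + 2 * (h * norm v)"
          by (simp add: algebra_simps)
        ultimately show ?thesis using \<open>h > 0\<close> unfolding distrib_left by linarith
      qed
      also have "\<dots> = d" unfolding h_def using pos by (simp add: field_simps)
      finally show ?thesis .
    qed
    then have S: "p + s *\<^sub>R x + t *\<^sub>R y \<in> S"
      if "0 \<le> s" "s \<le> h" "0 \<le> t" "t \<le> h" "{x, y} = {u, v}" for s t x y
      using near[OF that] d1(2) by (auto simp: d_def dist_commute)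
    define \<Delta> where "\<Delta> = f (p + h *\<^sub>R u + h *\<^sub>R v) - f (p + h *\<^sub>R u) - f (p + h *\<^sub>R v) + f p"
    obtain s t where st: "0 \<le> s" "s \<le> h" "0 \<le> t" "t \<le> h" "\<Delta> = h\<^sup>2 * F u v (p + s *\<^sub>R u + t *\<^sub>R v)"
      using second_difference_mean_value[OF assms(2) \<open>h > 0\<close> S, of u v] unfolding \<Delta>_def F_def by auto
    obtain s' t' where st': "0 \<le> s'" "s' \<le> h" "0 \<le> t'" "t' \<le> h" "\<Delta> = h\<^sup>2 * F v u (p + s' *\<^sub>R v + t' *\<^sub>R u)"
      using second_difference_mean_value[OF assms(2) \<open>h > 0\<close> S, of v u] unfolding \<Delta>_def F_def
      by (auto simp: insert_commute algebra_simps)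
    have "F u v (p + s *\<^sub>R u + t *\<^sub>R v) = F v u (p + s' *\<^sub>R v + t' *\<^sub>R u)"
      using st(5) st'(5) \<open>h > 0\<close> by simp
    moreover have "dist (F u v (p + s *\<^sub>R u + t *\<^sub>R v)) (F u v p) < e / 2"
      using near[OF st(1-4), of u v] by (intro d2) (simp add: d_def)
    moreover have "dist (F v u (p + s' *\<^sub>R v + t' *\<^sub>R u)) (F v u p) < e / 2"
      using near[OF st'(1-4), of v u] by (intro d3) (simp add: d_def insert_commute)
    ultimately show ?thesis unfolding dist_real_def by linarith
  qed
  then have "\<bar>F u v p - F v u p\<bar> \<le> 0" by (rule field_le_epsilon) simp
  then show ?thesis by (simp add: F_def)
qed

text \<open>Pairing with a fixed vector \<open>c\<close> commutes with differentiation and leads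
  back to real functions; the inner products with all \<open>c\<close> determine a vector.\<close>

lemma mixed_derivatives_commute:
  fixes f :: "'a::real_normed_vector \<Rightarrow> 'b::real_inner"
  assumes "open S" "smooth_on S f" "p \<in> S"
  shows "frechet_derivative (\<lambda>q. frechet_derivative f (at q) u) (at p) v =
    frechet_derivative (\<lambda>q. frechet_derivative f (at q) v) (at p) u" (is "?L = ?R")
proof -
  have inner: "frechet_derivative (\<lambda>q. frechet_derivative (\<lambda>q. f q \<bullet> c) (at q) u) (at p) v =
    frechet_derivative (\<lambda>q. frechet_derivative f (at q) u) (at p) v \<bullet> c" for c u v
  proof -
    have "((\<lambda>q. frechet_derivative f (at q) u \<bullet> c) has_derivative
        (\<lambda>v. frechet_derivative (\<lambda>q. frechet_derivative f (at q) u) (at p) v \<bullet> c)) (at p)"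
      by (rule bounded_linear.has_derivative[OF bounded_linear_inner_left
            smooth_on_has_derivative[OF smooth_on_frechet_derivative[OF assms(2)] assms(3)]])
    then have "((\<lambda>q. frechet_derivative (\<lambda>q. f q \<bullet> c) (at q) u) has_derivative
        (\<lambda>v. frechet_derivative (\<lambda>q. frechet_derivative f (at q) u) (at p) v \<bullet> c)) (at p)"
      by (rule has_derivative_transform_within_open[OF _ assms(1,3)])
        (simp add: frechet_derivative_linear[OF bounded_linear_inner_left assms(2)])
    from frechet_derivative_eqI[OF this] show ?thesis by simp
  qed
  have "?L \<bullet> c = ?R \<bullet> c" for c
    using mixed_derivatives_commute_real[OF assms(1)
        smooth_on_linear[OF assms(1) bounded_linear_inner_left assms(2)] assms(3), of c u v]
    by (simp add: inner)
  then show ?thesis by (rule vector_eq_rdot[THEN iffD1, OF allI])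
qed

section \<open>Derivatives in the coordinate plane\<close>

lemma frechet_derivative_plane:
  assumes "smooth_on S f" "p \<in> S"
  shows "frechet_derivative f (at p) v = fst v *\<^sub>R pdx f p + snd v *\<^sub>R pdy f p"
proof -
  have "linear (frechet_derivative f (at p))"
    using smooth_on_has_derivative[OF assms] has_derivative_linear by blast
  then have "frechet_derivative f (at p) (fst v *\<^sub>R (1, 0) + snd v *\<^sub>R (0, 1))
      = fst v *\<^sub>R pdx f p + snd v *\<^sub>R pdy f p"
    by (simp only: linear_add linear_cmul pdx_def pdy_def)
  then show ?thesis by simp
qed

text \<open>The product rule for a constant inner product, applied below to pairs of frame vectors
  and tangents.\<close>

lemma inner_constant_derivative:
  assumes "open S" "smooth_on S f" "smooth_on S g" "\<And>q. q \<in> S \<Longrightarrow> f q \<bullet> g q = c" "p \<in> S"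
  shows "f p \<bullet> frechet_derivative g (at p) v + frechet_derivative f (at p) v \<bullet> g p = 0"
proof -
  have "((\<lambda>q. f q \<bullet> g q) has_derivative
      (\<lambda>v. f p \<bullet> frechet_derivative g (at p) v + frechet_derivative f (at p) v \<bullet> g p)) (at p)"
    using assms by (intro has_derivative_inner smooth_on_has_derivative)
  moreover have "((\<lambda>q. f q \<bullet> g q) has_derivative (\<lambda>v. 0)) (at p)"
    by (rule has_derivative_transform_within_open[OF has_derivative_const assms(1,5)]) (simp add: assms)
  ultimately have "(\<lambda>v. f p \<bullet> frechet_derivative g (at p) v + frechet_derivative f (at p) v \<bullet> g p) = (\<lambda>v. 0)"
    by (rule has_derivative_unique)
  from fun_cong[OF this] show ?thesis .
qed

lemma smooth_on_pdx: "smooth_on S f \<Longrightarrow> smooth_on S (pdx f)"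
  and smooth_on_pdy: "smooth_on S f \<Longrightarrow> smooth_on S (pdy f)"
  unfolding pdx_def[abs_def] pdy_def[abs_def] by (simp_all add: smooth_on_frechet_derivative)

section \<open>Orthogonal frames at a point\<close>

lemma orthogonal_matrix_rows:
  fixes b :: "'n::finite \<Rightarrow> real^'n"
  assumes "\<And>i j. b i \<bullet> b j = (if i = j then 1 else 0)"
  shows "orthogonal_matrix (\<chi> i. b i)"
proof -
  have "(\<chi> i. b i) ** transpose (\<chi> i. b i) = mat 1"
    using assms by (simp add: vec_eq_iff matrix_matrix_mult_def transpose_def mat_def inner_vec_def)
  then show ?thesis
    unfolding orthogonal_matrix_def using matrix_left_right_inverse by blast
qed

text \<open>Here \<open>x\<close> and \<open>y\<close> stand for the coordinate tangents, which need
  not have unit length, and \<open>w\<close> collects the radius-vector and the normals. In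
  \<open>real^(2 + 'm)\<close> all of them together form an orthogonal basis.\<close>

definition adapted_frame :: "'e::real_inner \<Rightarrow> 'e \<Rightarrow> ('m \<Rightarrow> 'e) \<Rightarrow> bool" where
  "adapted_frame x y w \<longleftrightarrow> x \<noteq> 0 \<and> y \<noteq> 0 \<and> x \<bullet> y = 0 \<and>
     (\<forall>\<alpha> \<beta>. w \<alpha> \<bullet> w \<beta> = (if \<alpha> = \<beta> then 1 else 0)) \<and> (\<forall>\<alpha>. w \<alpha> \<bullet> x = 0 \<and> w \<alpha> \<bullet> y = 0)"

text \<open>The two tangent vectors are sent to the diagonals of the first coordinate plane; this is what
  keeps the angle \<open>\<phi>\<close> away from the zeros of sine and cosine.\<close>

lemma adapted_frame_straighten:
  fixes w :: "'m::finite \<Rightarrow> real^(2 + 'm)"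
  assumes "adapted_frame x y w"
  obtains T :: "real^(2 + 'm) \<Rightarrow> real^(2 + 'm)" where "orthogonal_transformation T" "\<And>\<alpha>. T (w \<alpha>) = axis (Inr \<alpha>) 1"
    "T x $ Inl 1 \<noteq> 0" "T x $ Inl 2 \<noteq> 0"
    "\<And>u v. \<lbrakk>\<And>\<alpha>. u \<bullet> w \<alpha> = 0; v \<bullet> x = 0; v \<bullet> y = 0\<rbrakk> \<Longrightarrow> u \<bullet> v = 0"
proof -
  \<comment> \<open>Both \<open>e1\<close> and \<open>e2\<close> get squared length 1/2, so that
    their sum and difference are unit vectors; \<open>x\<close>, parallel to \<open>e1\<close>, has
    a nonzero component along each.\<close>
  define e1 where "e1 = (inverse (sqrt 2 * norm x)) *\<^sub>R x"
  define e2 where "e2 = (inverse (sqrt 2 * norm y)) *\<^sub>R y"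
  define b where "b = case_sum (\<lambda>i::2. if i = 1 then e1 + e2 else e1 - e2) w"
  have ne: "x \<noteq> 0" "y \<noteq> 0" "x \<bullet> y = 0" "y \<bullet> x = 0" using assms by (auto simp: adapted_frame_def inner_commute)
  have w: "w \<alpha> \<bullet> w \<beta> = (if \<alpha> = \<beta> then 1 else 0)" "w \<alpha> \<bullet> x = 0" "w \<alpha> \<bullet> y = 0" "x \<bullet> w \<alpha> = 0" "y \<bullet> w \<alpha> = 0" for \<alpha> \<beta>
    using assms by (auto simp: adapted_frame_def inner_commute)
  have e: "e1 \<bullet> e1 = 1/2" "e2 \<bullet> e2 = 1/2" "e1 \<bullet> e2 = 0" "e2 \<bullet> e1 = 0"
    using ne by (simp_all add: e1_def e2_def dot_square_norm power2_eq_square field_simps)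
  have ew: "e1 \<bullet> w \<alpha> = 0" "e2 \<bullet> w \<alpha> = 0" "w \<alpha> \<bullet> e1 = 0" "w \<alpha> \<bullet> e2 = 0" for \<alpha>
    using w by (simp_all add: e1_def e2_def)
  have b: "b i \<bullet> b j = (if i = j then 1 else 0)" for i j
    using exhaust_2
    by (cases i; cases j) (auto simp: b_def w e ew inner_add_left inner_add_right
        inner_diff_left inner_diff_right)
  define T where "T v = (\<chi> i. b i) *v v" for v
  have Tc: "T v $ i = b i \<bullet> v" for v i
    by (simp add: T_def matrix_vector_mult_def inner_vec_def)
  have T: "orthogonal_transformation T"
    using orthogonal_matrix_rows[OF b] unfolding T_def[abs_def]
    by (simp add: orthogonal_transformation_matrix)
  have "T (w \<alpha>) = axis (Inr \<alpha>) 1" for \<alpha>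
  proof -
    have "b i \<bullet> w \<alpha> = (if i = Inr \<alpha> then 1 else 0)" for i
      using b[of i "Inr \<alpha>"] by (simp add: b_def)
    then show ?thesis by (simp add: vec_eq_iff Tc axis_def)
  qed
  moreover have "e1 \<bullet> x \<noteq> 0" "e2 \<bullet> x = 0" using ne by (simp_all add: e1_def e2_def)
  then have "T x $ Inl 1 \<noteq> 0" "T x $ Inl 2 \<noteq> 0"
    by (simp_all add: Tc b_def inner_add_left inner_diff_left)
  \<comment> \<open>In the orthonormal basis \<open>b\<close>, \<open>u\<close> has only plane
    components and \<open>v\<close> only components along the \<open>w\<close>, so every product
    vanishes.\<close>
  moreover have "u \<bullet> v = 0" if "\<And>\<alpha>. u \<bullet> w \<alpha> = 0" "v \<bullet> x = 0" "v \<bullet> y = 0" for u v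
  proof -
    have "u \<bullet> v = T u \<bullet> T v" using T by (simp add: orthogonal_transformation_def)
    also have "\<dots> = (\<Sum>i\<in>UNIV. (b i \<bullet> u) * (b i \<bullet> v))" by (simp add: inner_vec_def Tc)
    also have "\<dots> = 0"
    proof (rule sum.neutral, rule ballI)
      fix i
      show "(b i \<bullet> u) * (b i \<bullet> v) = 0"
        using that by (cases i) (auto simp: b_def e1_def e2_def inner_commute inner_add_right inner_diff_right)
    qed
    finally show ?thesis .
  qed
  ultimately show thesis by (rule that[OF T])
qed

subsection \<open>Surfaces with an orthonormal frame of curvature type\<close>

text \<open>The notion through which both directions pass. The radius-vector is the member
  \<open>w \<gamma>\<close>, on the same footing as the normals; the last condition is Rodrigues'
  formula for lines of curvature.\<close>

definition curvature_frame ::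
  "plane set \<Rightarrow> 'm \<Rightarrow> ('m::finite \<Rightarrow> plane \<Rightarrow> real^(2 + 'm)) \<Rightarrow> bool" where
  "curvature_frame D \<gamma> w \<longleftrightarrow> open D \<and> (\<forall>\<alpha>. smooth_on D (w \<alpha>)) \<and>
     (\<forall>p\<in>D. adapted_frame (pdx (w \<gamma>) p) (pdy (w \<gamma>) p) (\<lambda>\<alpha>. w \<alpha> p)) \<and>
     (\<forall>p\<in>D. \<forall>\<alpha>. (\<exists>a. pdx (w \<alpha>) p = a *\<^sub>R pdx (w \<gamma>) p) \<and> (\<exists>b. pdy (w \<alpha>) p = b *\<^sub>R pdy (w \<gamma>) p))"

text \<open>Injectivity of a linear map means trivial kernel, and two orthogonal vectors are
  independent exactly when neither is zero.\<close>

lemma immersion_on_iff_independent: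
  assumes "smooth_on D r" "\<And>p. p \<in> D \<Longrightarrow> pdx r p \<bullet> pdy r p = 0"
  shows "immersion_on D r \<longleftrightarrow> (\<forall>p\<in>D. pdx r p \<noteq> 0 \<and> pdy r p \<noteq> 0)"
proof -
  have "inj (frechet_derivative r (at p)) \<longleftrightarrow> pdx r p \<noteq> 0 \<and> pdy r p \<noteq> 0" if p: "p \<in> D" for p
  proof -
    have lin: "linear (frechet_derivative r (at p))"
      using smooth_on_has_derivative[OF assms(1) p] has_derivative_linear by blast
    note D = frechet_derivative_plane[OF assms(1) p]
    show ?thesis
    proof
      assume "inj (frechet_derivative r (at p))"
      then have "frechet_derivative r (at p) v \<noteq> 0" if "v \<noteq> 0" for v
        using that lin linear_injective_0 by blast
      from this[of "(1, 0)"] this[of "(0, 1)"] show "pdx r p \<noteq> 0 \<and> pdy r p \<noteq> 0"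
        by (simp add: D zero_prod_def)
    next
      assume ne: "pdx r p \<noteq> 0 \<and> pdy r p \<noteq> 0"
      have "v = 0" if "frechet_derivative r (at p) v = 0" for v
      proof -
        have "fst v *\<^sub>R pdx r p + snd v *\<^sub>R pdy r p = 0" using that D by simp
        then have "(fst v *\<^sub>R pdx r p + snd v *\<^sub>R pdy r p) \<bullet> pdx r p = 0"
          "(fst v *\<^sub>R pdx r p + snd v *\<^sub>R pdy r p) \<bullet> pdy r p = 0" by auto
        then have "fst v = 0" "snd v = 0"
          using ne assms(2)[OF p] by (auto simp: inner_add_left inner_add_right inner_commute)
        then show ?thesis by (simp add: prod_eq_iff)
      qed
      then show "inj (frechet_derivative r (at p))" using lin linear_injective_0 by blast
    qed
  qed
  then show ?thesis by (auto simp: immersion_on_def)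
qed

text \<open>The last two identities differentiate the first two crosswise. They express the
  off-diagonal terms of the second fundamental form through the mixed derivatives of
  \<open>r\<close>.\<close>

lemma parallel_normals_derivative:
  assumes "parallel_normals N r I n" "smooth_on N r" "open N" "p \<in> N" "i \<in> I"
  shows "n i p \<bullet> pdx r p = 0" "n i p \<bullet> pdy r p = 0"
    "pdy (n i) p \<bullet> pdx r p + n i p \<bullet> pdy (pdx r) p = 0"
    "pdx (n i) p \<bullet> pdy r p + n i p \<bullet> pdx (pdy r) p = 0"
proof -
  have t: "n i q \<bullet> frechet_derivative r (at q) v = 0" if "q \<in> N" for q v
    using assms that unfolding parallel_normals_def tangent_plane_def by blast
  then have x: "n i q \<bullet> pdx r q = 0" and y: "n i q \<bullet> pdy r q = 0" if "q \<in> N" for q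
    using that unfolding pdx_def pdy_def by auto
  have n: "smooth_on N (n i)" using assms unfolding parallel_normals_def by blast
  show "n i p \<bullet> pdx r p = 0" "n i p \<bullet> pdy r p = 0" using x y assms by auto
  show "pdy (n i) p \<bullet> pdx r p + n i p \<bullet> pdy (pdx r) p = 0"
    using inner_constant_derivative[OF assms(3) n smooth_on_pdx[OF assms(2)] x assms(4), of "(0, 1)"]
    unfolding pdy_def by (simp add: add.commute)
  show "pdx (n i) p \<bullet> pdy r p + n i p \<bullet> pdx (pdy r) p = 0"
    using inner_constant_derivative[OF assms(3) n smooth_on_pdy[OF assms(2)] y assms(4), of "(1, 0)"]
    unfolding pdx_def by (simp add: add.commute)
qed

context
  fixes D :: "plane set" and \<gamma> :: "'m::finite" and w :: "'m::finite \<Rightarrow> plane \<Rightarrow> real^(2 + 'm)"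
  assumes frame: "curvature_frame D \<gamma> w"
begin

lemma curvature_frame_smooth: "open D" "smooth_on D (w \<alpha>)"
  using frame by (auto simp: curvature_frame_def)

lemma curvature_frame_inner:
  assumes "p \<in> D"
  shows "w \<alpha> p \<bullet> w \<beta> p = (if \<alpha> = \<beta> then 1 else 0)"
    "w \<alpha> p \<bullet> pdx (w \<gamma>) p = 0" "w \<alpha> p \<bullet> pdy (w \<gamma>) p = 0"
    "pdx (w \<gamma>) p \<bullet> pdy (w \<gamma>) p = 0" "pdx (w \<gamma>) p \<noteq> 0" "pdy (w \<gamma>) p \<noteq> 0"
  using frame assms by (auto simp: curvature_frame_def adapted_frame_def)

lemma curvature_frame_derivative:
  assumes "p \<in> D"
  obtains a b where "pdx (w \<alpha>) p = a *\<^sub>R pdx (w \<gamma>) p" "pdy (w \<alpha>) p = b *\<^sub>R pdy (w \<gamma>) p"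
  using frame assms unfolding curvature_frame_def by meson

lemma curvature_frame_inner_derivative:
  assumes "p \<in> D"
  shows "w \<alpha> p \<bullet> frechet_derivative (w \<beta>) (at p) v = 0"
proof -
  obtain a b where "pdx (w \<beta>) p = a *\<^sub>R pdx (w \<gamma>) p" "pdy (w \<beta>) p = b *\<^sub>R pdy (w \<gamma>) p"
    using curvature_frame_derivative[OF assms] .
  then show ?thesis
    using curvature_frame_inner[OF assms]
    by (simp add: frechet_derivative_plane[OF curvature_frame_smooth(2) assms] inner_add_right)
qed

lemma curvature_frame_surface: "surface_in_sphere D (w \<gamma>)"
proof -
  have "norm (w \<gamma> p) = 1" if "p \<in> D" for p
    using curvature_frame_inner(1)[OF that, of \<gamma> \<gamma>] by (simp add: norm_eq_1)
  moreover have "immersion_on D (w \<gamma>)"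
    using immersion_on_iff_independent[OF curvature_frame_smooth(2)] curvature_frame_inner by blast
  ultimately show ?thesis
    using curvature_frame_smooth by (auto simp: surface_in_sphere_def)
qed

lemma curvature_frame_parallel_normals: "parallel_normals D (w \<gamma>) (UNIV - {\<gamma>}) w"
  unfolding parallel_normals_def tangent_plane_def
proof (intro conjI ballI)
  fix p \<alpha> assume p: "p \<in> D"
  obtain a b where ab: "pdx (w \<alpha>) p = a *\<^sub>R pdx (w \<gamma>) p" "pdy (w \<alpha>) p = b *\<^sub>R pdy (w \<gamma>) p"
    using curvature_frame_derivative[OF p] .
  \<comment> \<open>Stretching the coordinates of \<open>v\<close> by \<open>a\<close> and
    \<open>b\<close> absorbs the proportionality factors.\<close>
  have "frechet_derivative (w \<alpha>) (at p) v = frechet_derivative (w \<gamma>) (at p) (fst v * a, snd v * b)" for v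
    by (simp add: frechet_derivative_plane[OF curvature_frame_smooth(2) p] ab)
  then show "range (frechet_derivative (w \<alpha>) (at p)) \<subseteq> range (frechet_derivative (w \<gamma>) (at p))"
    by auto
qed (auto simp: curvature_frame_smooth curvature_frame_inner curvature_frame_inner_derivative)

lemma curvature_frame_flat: "has_flat_normal_bundle D (w \<gamma>)"
proof -
  \<comment> \<open>The space has dimension \<open>CARD('m) + 2\<close>, so subtracting
    \<open>3\<close> leaves the number of indices other than \<open>\<gamma>\<close>;
    \<open>\<sigma>\<close> then renumbers these normals as flatness demands.\<close>
  have "card (UNIV - {\<gamma>}) = DIM(real^(2 + 'm)) - 3"
    by (simp add: card_Diff_singleton)
  then obtain \<sigma> where \<sigma>: "bij_betw \<sigma> {..<DIM(real^(2 + 'm)) - 3} (UNIV - {\<gamma>})"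
    using ex_bij_betw_nat_finite[of "UNIV - {\<gamma>}"] by (auto simp: atLeast0LessThan)
  have "\<sigma> i = \<sigma> j \<longleftrightarrow> i = j" "\<sigma> i \<in> UNIV - {\<gamma>}"
    if "i \<in> {..<DIM(real^(2 + 'm)) - 3}" "j \<in> {..<DIM(real^(2 + 'm)) - 3}" for i j
    using \<sigma> that unfolding bij_betw_def by (blast dest: inj_onD, blast)
  then have "parallel_normals D (w \<gamma>) {..<DIM(real^(2 + 'm)) - 3} (\<lambda>i. w (\<sigma> i))"
    using curvature_frame_parallel_normals unfolding parallel_normals_def by simp
  then show ?thesis
    using curvature_frame_smooth(1) unfolding has_flat_normal_bundle_def by blast
qed

text \<open>The columns are orthogonal to the mixed derivative of \<open>w \<gamma>\<close>, which is therefore tangent, hence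
  orthogonal to every other choice of parallel normals as well.\<close>

lemma curvature_frame_coordinates: "curvature_line_coordinates D (w \<gamma>)"
  unfolding curvature_line_coordinates_def
proof (intro conjI allI impI ballI)
  fix p assume p: "p \<in> D"
  show "no_dxdy_term (diff_form (w \<gamma>) (w \<gamma>) p)"
    unfolding no_dxdy_term_def diff_form_def
    by (rule exI[of _ "pdx (w \<gamma>) p \<bullet> pdx (w \<gamma>) p"], rule exI[of _ "pdy (w \<gamma>) p \<bullet> pdy (w \<gamma>) p"])
      (use curvature_frame_inner(4)[OF p] in \<open>simp add: frechet_derivative_plane[OF curvature_frame_smooth(2) p]
        inner_add_left inner_add_right power2_eq_square inner_commute\<close>)
next
  fix N p i and n :: "nat \<Rightarrow> plane \<Rightarrow> real^(2 + 'm)"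
  assume N: "open N \<and> N \<subseteq> D \<and> parallel_normals N (w \<gamma>) {..<DIM(real^(2 + 'm)) - 3} n"
    and p: "p \<in> N" and i: "i < DIM(real^(2 + 'm)) - 3"
  then have pD: "p \<in> D" and sN: "smooth_on N (w \<gamma>)"
    using smooth_on_subset curvature_frame_smooth by blast+
  have ns: "smooth_on N (n i)" using N i unfolding parallel_normals_def by blast
  note n = parallel_normals_derivative[OF _ sN _ p, of _ n i]
  have nx: "n i p \<bullet> pdx (w \<gamma>) p = 0" and ny: "n i p \<bullet> pdy (w \<gamma>) p = 0"
    and nyx: "pdy (n i) p \<bullet> pdx (w \<gamma>) p + n i p \<bullet> pdy (pdx (w \<gamma>)) p = 0"
    and nxy: "pdx (n i) p \<bullet> pdy (w \<gamma>) p + n i p \<bullet> pdx (pdy (w \<gamma>)) p = 0"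
    using n N i by blast+
  \<comment> \<open>A vector orthogonal to all columns is tangent because the frame spans the space,
    and \<open>n i p\<close> is orthogonal to the tangents.\<close>
  have tangent: "n i p \<bullet> z = 0" if "\<And>\<alpha>. z \<bullet> w \<alpha> p = 0" for z
  proof -
    have "adapted_frame (pdx (w \<gamma>) p) (pdy (w \<gamma>) p) (\<lambda>\<alpha>. w \<alpha> p)"
      using frame pD by (simp add: curvature_frame_def)
    then have "z \<bullet> n i p = 0"
      by (rule adapted_frame_straighten) (use that nx ny in blast)
    then show ?thesis by (simp add: inner_commute)
  qed
  \<comment> \<open>Differentiating the orthogonality of \<open>pdx (w \<gamma>)\<close> and
    \<open>w \<alpha>\<close> in the second coordinate moves the derivative onto
    \<open>w \<alpha>\<close>, where it is a multiple of \<open>pdy (w \<gamma>)\<close> and so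
    orthogonal to \<open>pdx (w \<gamma>)\<close>; likewise with the coordinates exchanged.\<close>
  have "pdy (pdx (w \<gamma>)) p \<bullet> w \<alpha> p = 0" "pdx (pdy (w \<gamma>)) p \<bullet> w \<alpha> p = 0" for \<alpha>
  proof -
    obtain a b where ab: "pdx (w \<alpha>) p = a *\<^sub>R pdx (w \<gamma>) p" "pdy (w \<alpha>) p = b *\<^sub>R pdy (w \<gamma>) p"
      using curvature_frame_derivative[OF pD] .
    show "pdy (pdx (w \<gamma>)) p \<bullet> w \<alpha> p = 0"
      using inner_constant_derivative[OF curvature_frame_smooth(1) smooth_on_pdx[OF curvature_frame_smooth(2)]
          curvature_frame_smooth(2) _ pD, of \<gamma> \<alpha> 0 "(0, 1)"] curvature_frame_inner ab pD
      by (simp add: pdy_def[symmetric] inner_commute)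
    show "pdx (pdy (w \<gamma>)) p \<bullet> w \<alpha> p = 0"
      using inner_constant_derivative[OF curvature_frame_smooth(1) smooth_on_pdy[OF curvature_frame_smooth(2)]
          curvature_frame_smooth(2) _ pD, of \<gamma> \<alpha> 0 "(1, 0)"] curvature_frame_inner ab pD
      by (simp add: pdx_def[symmetric] inner_commute)
  qed
  then have "pdy (n i) p \<bullet> pdx (w \<gamma>) p = 0" "pdx (n i) p \<bullet> pdy (w \<gamma>) p = 0"
    using nxy nyx tangent by simp_all
  then show "no_dxdy_term (diff_form (w \<gamma>) (n i) p)"
    unfolding no_dxdy_term_def diff_form_def
    by (intro exI[of _ "pdx (w \<gamma>) p \<bullet> pdx (n i) p"] exI[of _ "pdy (w \<gamma>) p \<bullet> pdy (n i) p"])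
      (simp add: frechet_derivative_plane[OF curvature_frame_smooth(2) pD] frechet_derivative_plane[OF ns p]
        inner_add_left inner_add_right power2_eq_square inner_commute)
qed

end

subsection \<open>Matrix identities\<close>

definition stack :: "real^'n^'a \<Rightarrow> real^'n^'b \<Rightarrow> real^'n^('a::finite + 'b::finite)" where
  "stack A B = (\<chi> i. case i of Inl a \<Rightarrow> A $ a | Inr b \<Rightarrow> B $ b)"

lemma stack_component [simp]: "stack A B $ Inl a = A $ a" "stack A B $ Inr b = B $ b"
  by (simp_all add: stack_def)

lemma transpose_stack_mult:
  "transpose (stack A B) ** stack C E = transpose A ** C + transpose B ** E"
  by (simp add: vec_eq_iff matrix_matrix_mult_def transpose_def UNIV_Plus_UNIV[symmetric]
      sum.Plus del: UNIV_Plus_UNIV)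

lemma inner_columns: "column i A \<bullet> column j B = (transpose A ** B) $ i $ j"
  for A B :: "real^'n^'m"
  by (simp add: column_def inner_vec_def matrix_matrix_mult_def transpose_def)

lemma bounded_linear_stack: "bounded_linear (\<lambda>(A, B). stack A B)"
proof -
  have "linear (\<lambda>(A, B). stack A B)"
    by (rule linearI) (auto simp: stack_def vec_eq_iff split: sum.splits)
  then show ?thesis by (simp add: linear_conv_bounded_linear)
qed

lemma has_derivative_stack:
  assumes "(f has_derivative f') (at p)" "(g has_derivative g') (at p)"
  shows "((\<lambda>p. stack (f p) (g p)) has_derivative (\<lambda>v. stack (f' v) (g' v))) (at p)"
  using bounded_linear.has_derivative[OF bounded_linear_stack has_derivative_Pair[OF assms]] by simp

lemma bounded_linear_column: "bounded_linear (\<lambda>A :: real^'n^'m. column i A)"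
proof -
  have "linear (\<lambda>A :: real^'n^'m. column i A)"
    by (rule linearI) (auto simp: column_def vec_eq_iff)
  then show ?thesis by (simp add: linear_conv_bounded_linear)
qed

lemma transpose_add: "transpose (A + B) = transpose A + transpose B"
  and transpose_diff: "transpose (A - B) = transpose A - transpose B"
  and transpose_minus: "transpose (- A) = - transpose A" for A B :: "real^'n^'m"
  by (simp_all add: transpose_def vec_eq_iff)

lemmas matrix_mult_expand =
  bounded_bilinear.add_left[OF bounded_bilinear_matrix_mult]
  bounded_bilinear.add_right[OF bounded_bilinear_matrix_mult]
  bounded_bilinear.diff_left[OF bounded_bilinear_matrix_mult]
  bounded_bilinear.diff_right[OF bounded_bilinear_matrix_mult]
  bounded_bilinear.minus_left[OF bounded_bilinear_matrix_mult]
  bounded_bilinear.minus_right[OF bounded_bilinear_matrix_mult]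
  matrix_mul_assoc[symmetric] matrix_transpose_mul transpose_add transpose_diff transpose_minus

context
  fixes U :: "real^'m^2" and V Z :: "real^'m^'m"
  assumes VZ: "V ** Z = mat 1" "Z ** V = mat 1"
    and VV: "V + transpose V = transpose U ** U + mat 1"
begin

text \<open>Rewrite rules for products associated to the right; the trailing \<open>X\<close> lets
  them act inside longer products. The last one trades \<open>U\<close> for \<open>V\<close> and its
  transpose.\<close>

private lemma cancel:
  "V ** (Z ** X) = X" "Z ** (V ** X) = X"
  "transpose V ** (transpose Z ** X) = X" "transpose Z ** (transpose V ** X) = X"
  "transpose U ** (U ** X) = V ** X + transpose V ** X - X" for X :: "real^'k^'m"
proof -
  have "transpose V ** transpose Z = mat 1" "transpose Z ** transpose V = mat 1"
    using VZ by (simp_all add: matrix_transpose_mul[symmetric])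
  moreover have "transpose U ** U = V + transpose V - mat 1" using VV by simp
  ultimately show "V ** (Z ** X) = X" "Z ** (V ** X) = X"
    "transpose V ** (transpose Z ** X) = X" "transpose Z ** (transpose V ** X) = X"
    "transpose U ** (U ** X) = V ** X + transpose V ** X - X"
    using VZ by (simp_all add: matrix_mul_assoc bounded_bilinear.add_left[OF bounded_bilinear_matrix_mult]
        bounded_bilinear.diff_left[OF bounded_bilinear_matrix_mult])
qed

text \<open>The upper block contributes \<open>Z + transpose Z - transpose Z ** Z\<close>, and the
  lower block exactly what is missing to \<open>mat 1\<close>.\<close>

lemma W_orthonormal:
  "transpose (stack (U ** Z) (Z - mat 1)) ** stack (U ** Z) (Z - mat 1) = mat 1"
  by (simp add: transpose_stack_mult matrix_mult_expand cancel VZ)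

text \<open>The second factor is the derivative of the first when \<open>U\<close> has derivative
  \<open>E\<close> and \<open>V\<close> has derivative \<open>transpose U ** E\<close>.
  Orthonormality alone would make this product only skew; the special derivative of \<open>V\<close>
  makes it vanish.\<close>

lemma W_inner_derivative:
  "transpose (stack (U ** Z) (Z - mat 1)) **
    stack (E ** Z - U ** (Z ** (transpose U ** E ** Z))) (- (Z ** (transpose U ** E) ** Z)) = 0"
  by (simp add: transpose_stack_mult matrix_mult_expand cancel VZ)

text \<open>Both derivatives have the form \<open>A ** E ** Z\<close>, where \<open>A\<close> has
  blocks \<open>mat 1 - U ** Z ** transpose U\<close> and \<open>- (Z ** transpose U)\<close> and
  satisfies \<open>transpose A ** A = mat 1\<close>. Separate \<open>E\<close> and \<open>F\<close>
  allow two different directions.\<close>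

lemma W_derivative_inner_derivative:
  "transpose (stack (E ** Z - U ** (Z ** (transpose U ** E ** Z))) (- (Z ** (transpose U ** E) ** Z))) **
    stack (F ** Z - U ** (Z ** (transpose U ** F ** Z))) (- (Z ** (transpose U ** F) ** Z))
    = transpose Z ** transpose E ** F ** Z"
  by (simp add: transpose_stack_mult matrix_mult_expand cancel VZ)

end

text \<open>If \<open>X\<close> is an outer product with left factor \<open>t\<close>, the columns
  of \<open>M ** X\<close> all lie on the line of \<open>M *v t\<close>. This will make the
  derivatives of all columns of \<open>W\<close> in a coordinate direction parallel.\<close>

lemma column_stack_rank_one:
  fixes M :: "real^'k^'a::finite" and N :: "real^'k^'b::finite" and t :: "real^'k"
  assumes "\<And>i \<alpha>. X $ i $ \<alpha> = t $ i * \<xi> \<alpha>"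
  shows "column \<alpha> (stack (M ** X) (N ** X)) =
    \<xi> \<alpha> *\<^sub>R (\<chi> i. case i of Inl a \<Rightarrow> (M *v t) $ a | Inr b \<Rightarrow> (N *v t) $ b)"
  by (simp add: vec_eq_iff stack_def column_def matrix_matrix_mult_def matrix_vector_mult_def assms
      sum_distrib_left mult_ac split: sum.splits)

subsection \<open>The direct part\<close>

lemma matrix_inv_transpose:
  fixes A :: "real^'n^'n"
  assumes "invertible A"
  shows "matrix_inv (transpose A) = transpose (matrix_inv A)"
proof -
  have "transpose (matrix_inv A) ** (transpose A ** matrix_inv (transpose A)) = transpose (matrix_inv A)"
    using matrix_inv_mult(1)[OF transpose_invertible[OF assms]] by simp
  moreover have "transpose (matrix_inv A) ** transpose A = mat 1"
    by (simp add: matrix_transpose_mul[symmetric] matrix_inv_mult[OF assms])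
  ultimately show ?thesis by (simp add: matrix_mul_assoc)
qed

lemma W_matrix_stack: "W_matrix U V p = stack (U p ** matrix_inv (V p)) (matrix_inv (V p) - mat 1)"
  by (simp add: W_matrix_def stack_def)

text \<open>The product rule and the derivative of the inverse, with dV replaced by U^t dU; the
  result has the shape treated by the matrix identities above.\<close>

lemma has_derivative_W_matrix:
  fixes V :: "plane \<Rightarrow> real^'m^'m"
  assumes "open D" "smooth_on D U" "smooth_on D V" "p \<in> D"
    and inv: "\<And>p. p \<in> D \<Longrightarrow> invertible (V p)"
    and dV: "\<And>v. frechet_derivative V (at p) v = transpose (U p) ** frechet_derivative U (at p) v"
  defines "Z \<equiv> matrix_inv (V p)"
  shows "(W_matrix U V has_derivative (\<lambda>v.
    stack (frechet_derivative U (at p) v ** Z - U p ** (Z ** (transpose (U p) ** frechet_derivative U (at p) v ** Z)))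
      (- (Z ** (transpose (U p) ** frechet_derivative U (at p) v) ** Z)))) (at p)"
proof -
  have Z: "((\<lambda>p. matrix_inv (V p)) has_derivative
      (\<lambda>v. - (Z ** (transpose (U p) ** frechet_derivative U (at p) v) ** Z))) (at p)"
    using has_derivative_matrix_inv[OF assms(1,3) inv assms(4)] unfolding dV Z_def by simp
  have "((\<lambda>p. U p ** matrix_inv (V p)) has_derivative (\<lambda>v.
      frechet_derivative U (at p) v ** Z - U p ** (Z ** (transpose (U p) ** frechet_derivative U (at p) v ** Z)))) (at p)"
    using bounded_bilinear.FDERIV[OF bounded_bilinear_matrix_mult smooth_on_has_derivative[OF assms(2,4)] Z]
    by (simp add: Z_def[symmetric] matrix_mult_expand)
  from has_derivative_stack[OF this has_derivative_diff[OF Z has_derivative_const[of "mat 1"]]]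
  show ?thesis by (simp add: W_matrix_stack[abs_def])
qed

lemma smooth_on_stack:
  assumes "open S" "smooth_on S A" "smooth_on S B"
  shows "smooth_on S (\<lambda>p. stack (A p) (B p))"
proof -
  have "smooth_on S (\<lambda>p. stack (A p) (B p) $ i $ j)" for i j
    using assms by (cases i) (auto intro!: smooth_on_component)
  then have "smooth_on S (\<lambda>p. \<chi> i j. stack (A p) (B p) $ i $ j)"
    by (intro smooth_on_vec_lambda assms(1))
  then show ?thesis by simp
qed

lemma smooth_on_W_column:
  fixes V :: "plane \<Rightarrow> real^'m^'m"
  assumes "open D" "smooth_on D U" "smooth_on D V" "\<And>p. p \<in> D \<Longrightarrow> invertible (V p)"
  shows "smooth_on D (W_matrix U V)" "smooth_on D (W_column U V \<alpha>)"
proof -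
  show W: "smooth_on D (W_matrix U V)"
    unfolding W_matrix_stack[abs_def]
    by (intro smooth_on_stack smooth_on_matrix_mult smooth_on_diff smooth_on_matrix_inv smooth_on_const assms)
  show "smooth_on D (W_column U V \<alpha>)"
    unfolding W_column_def[abs_def]
    by (rule smooth_on_linear[OF assms(1) bounded_linear_column W])
qed

lemma smooth_on_U_matrix:
  assumes "open D" "\<And>\<alpha>. smooth_on D (\<kappa> \<alpha>)" "\<And>\<alpha>. smooth_on D (s \<alpha>)"
  shows "smooth_on D (U_matrix \<kappa> s)"
proof -
  have "smooth_on D (\<lambda>p. if i = 1 then \<kappa> \<alpha> p else s \<alpha> p)" for i :: 2 and \<alpha>
    using assms by (cases "i = 1") auto
  then show ?thesis
    unfolding U_matrix_def[abs_def] by (intro smooth_on_vec_lambda assms(1))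
qed

lemma frechet_derivative_U_matrix:
  assumes "open D" "\<And>\<alpha>. smooth_on D (\<kappa> \<alpha>)" "\<And>\<alpha>. smooth_on D (s \<alpha>)" "p \<in> D"
  shows "frechet_derivative (U_matrix \<kappa> s) (at p) v $ 1 $ \<alpha> = frechet_derivative (\<kappa> \<alpha>) (at p) v"
    "frechet_derivative (U_matrix \<kappa> s) (at p) v $ 2 $ \<alpha> = frechet_derivative (s \<alpha>) (at p) v"
proof -
  have bl: "bounded_linear (\<lambda>A. A $ i $ \<alpha>)" for i :: 2
    by (rule bounded_linear_compose[OF bounded_linear_vec_nth bounded_linear_vec_nth])
  have "frechet_derivative (U_matrix \<kappa> s) (at p) v $ i $ \<alpha> =
      frechet_derivative (\<lambda>q. U_matrix \<kappa> s q $ i $ \<alpha>) (at p) v" for i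
    by (rule frechet_derivative_linear[OF bl smooth_on_U_matrix[OF assms(1-3)] assms(4), symmetric])
  then show "frechet_derivative (U_matrix \<kappa> s) (at p) v $ 1 $ \<alpha> = frechet_derivative (\<kappa> \<alpha>) (at p) v"
    "frechet_derivative (U_matrix \<kappa> s) (at p) v $ 2 $ \<alpha> = frechet_derivative (s \<alpha>) (at p) v"
    by (simp_all add: U_matrix_def)
qed

context
  fixes D :: "plane set" and \<phi> :: "plane \<Rightarrow> real" and \<kappa> s :: "'m::finite \<Rightarrow> plane \<Rightarrow> real"
    and V :: "plane \<Rightarrow> real^'m^'m"
  assumes data: "construction_data D \<phi> \<kappa> s V"
begin

private abbreviation (input) "U \<equiv> U_matrix \<kappa> s"
private abbreviation (input) "W \<equiv> W_matrix U V"
private abbreviation (input) "w \<equiv> W_column U V"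
private abbreviation (input) "DU p v \<equiv> frechet_derivative U (at p) v"
private abbreviation (input) "DW p v \<equiv> frechet_derivative W (at p) v"

private lemma smooth:
  "open D" "smooth_on D (\<kappa> \<alpha>)" "smooth_on D (s \<alpha>)" "smooth_on D U" "smooth_on D V" "p \<in> D \<Longrightarrow> invertible (V p)"
  using data by (auto simp: construction_data_def intro!: smooth_on_U_matrix)

private lemma relation: "p \<in> D \<Longrightarrow> V p + transpose (V p) = transpose (U p) ** U p + mat 1"
  using data by (auto simp: construction_data_def)

private lemma DW: 
  assumes "p \<in> D"
  shows "DW p v = stack (DU p v ** matrix_inv (V p)
      - U p ** (matrix_inv (V p) ** (transpose (U p) ** DU p v ** matrix_inv (V p))))
    (- (matrix_inv (V p) ** (transpose (U p) ** DU p v) ** matrix_inv (V p)))"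
proof -
  have "frechet_derivative V (at p) v = transpose (U p) ** DU p v" for v
    using data assms unfolding construction_data_def by blast
  from frechet_derivative_eqI[OF has_derivative_W_matrix[OF smooth(1,4,5) assms smooth(6) this]]
  show ?thesis by simp
qed

private lemma Dw: "p \<in> D \<Longrightarrow> frechet_derivative (w \<alpha>) (at p) v = column \<alpha> (DW p v)"
  unfolding W_column_def[abs_def]
  by (rule frechet_derivative_linear[OF bounded_linear_column smooth_on_W_column(1)[OF smooth(1,4,5,6)]])

text \<open>A polarised formula: equal directions give the quadratic form of the theorem, the two
  coordinate directions give orthogonality of the tangents.\<close>

lemma derivative_W_gram:
  assumes "p \<in> D"
  shows "transpose (DW p u) ** DW p v
    = matrix_inv (transpose (V p)) ** transpose (DU p u) ** DU p v ** matrix_inv (V p)"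
  unfolding DW[OF assms] matrix_inv_transpose[OF smooth(6)[OF assms]]
  by (rule W_derivative_inner_derivative[OF matrix_inv_mult[OF smooth(6)[OF assms]] relation[OF assms]])

lemma diff_form_W_column:
  assumes "p \<in> D"
  shows "diff_form (w \<alpha>) (w \<beta>) p v =
    (matrix_inv (transpose (V p)) ** transpose (DU p v) ** DU p v ** matrix_inv (V p)) $ \<alpha> $ \<beta>"
  by (simp add: diff_form_def Dw[OF assms] inner_columns derivative_W_gram[OF assms])

text \<open>The linear system in rank-one form. The directions \<open>(tan \<phi>, 1)\<close> and
  \<open>(- cot \<phi>, 1)\<close> are orthogonal because tangent times cotangent is 1.\<close>

private lemma DU_columns:
  assumes "p \<in> D"
  shows "DU p (1, 0) $ i $ \<alpha> = vector [tan (\<phi> p), 1] $ i * pdx (s \<alpha>) p"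
    "DU p (0, 1) $ i $ \<alpha> = vector [- cot (\<phi> p), 1] $ i * pdy (s \<alpha>) p"
proof -
  note DU = frechet_derivative_U_matrix[of D \<kappa> s p, OF smooth(1-3) assms]
  have "pdx (\<kappa> \<alpha>) p = tan (\<phi> p) * pdx (s \<alpha>) p" "pdy (\<kappa> \<alpha>) p = - cot (\<phi> p) * pdy (s \<alpha>) p"
    using data assms unfolding construction_data_def by blast+
  then show "DU p (1, 0) $ i $ \<alpha> = vector [tan (\<phi> p), 1] $ i * pdx (s \<alpha>) p"
    "DU p (0, 1) $ i $ \<alpha> = vector [- cot (\<phi> p), 1] $ i * pdy (s \<alpha>) p"
    using exhaust_2[of i] by (auto simp: DU pdx_def pdy_def)
qed

private lemma rank_one:
  assumes p: "p \<in> D" and DU: "\<And>i \<alpha>. DU p v $ i $ \<alpha> = t $ i * \<sigma> \<alpha>"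
  obtains e \<xi> where "\<And>\<alpha>. frechet_derivative (w \<alpha>) (at p) v = \<xi> \<alpha> *\<^sub>R e"
proof -
  let ?Z = "matrix_inv (V p)"
  have X: "(DU p v ** ?Z) $ i $ \<alpha> = t $ i * (\<Sum>\<beta>\<in>UNIV. \<sigma> \<beta> * ?Z $ \<beta> $ \<alpha>)" for i \<alpha>
    by (simp add: matrix_matrix_mult_def DU sum_distrib_left mult.assoc)
  \<comment> \<open>The factor \<open>DU p v ** ?Z\<close>, still an outer product, is split off on
    the right of both blocks.\<close>
  have "DW p v = stack ((mat 1 - U p ** ?Z ** transpose (U p)) ** (DU p v ** ?Z))
      ((- (?Z ** transpose (U p))) ** (DU p v ** ?Z))"
    by (simp add: DW[OF p] matrix_mult_expand)
  with column_stack_rank_one[OF X] show thesis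
    by (intro that) (simp add: Dw[OF p])
qed

lemma W_column_curvature_frame:
  assumes "immersion_on D (w \<gamma>)"
  shows "curvature_frame D \<gamma> w"
proof -
  have sw: "smooth_on D (w \<alpha>)" for \<alpha>
    by (rule smooth_on_W_column(2)[OF smooth(1,4,5,6)])
  have orth: "w \<alpha> p \<bullet> w \<beta> p = (if \<alpha> = \<beta> then 1 else 0)" if p: "p \<in> D" for p \<alpha> \<beta>
    using W_orthonormal[OF matrix_inv_mult[OF smooth(6)[OF p]] relation[OF p]]
    by (simp add: W_column_def inner_columns W_matrix_stack mat_def)
  have normal: "w \<alpha> p \<bullet> frechet_derivative (w \<beta>) (at p) v = 0" if p: "p \<in> D" for p \<alpha> \<beta> v
    using W_inner_derivative[OF matrix_inv_mult[OF smooth(6)[OF p]] relation[OF p], of "DU p v"]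
    by (simp add: Dw[OF p] W_column_def inner_columns W_matrix_stack DW[OF p])
  have xy: "pdx (w \<gamma>) p \<bullet> pdy (w \<gamma>) p = 0" if p: "p \<in> D" for p
  proof -
    have sc: "sin (\<phi> p) \<noteq> 0" "cos (\<phi> p) \<noteq> 0" using data p by (auto simp: construction_data_def)
    \<comment> \<open>The two rank-one directions are orthogonal, and
      \<open>derivative_W_gram\<close> transfers this to the columns of \<open>W\<close>.\<close>
    have "(transpose (DU p (1, 0)) ** DU p (0, 1)) $ \<alpha> $ \<beta> = 0" for \<alpha> \<beta>
      using sc by (simp add: matrix_matrix_mult_def transpose_def sum_2 DU_columns[OF p] tan_def cot_def)
    then have "transpose (DU p (1, 0)) ** DU p (0, 1) = 0" by (simp add: vec_eq_iff)
    then have "transpose (DW p (1, 0)) ** DW p (0, 1) = 0"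
      by (simp add: derivative_W_gram[OF p] matrix_mul_assoc[symmetric])
    then show ?thesis by (simp add: pdx_def pdy_def Dw[OF p] inner_columns)
  qed
  have ne: "pdx (w \<gamma>) p \<noteq> 0" "pdy (w \<gamma>) p \<noteq> 0" if "p \<in> D" for p
    using assms immersion_on_iff_independent[OF sw xy] that by blast+
  have "\<exists>a. pdx (w \<alpha>) p = a *\<^sub>R pdx (w \<gamma>) p" if p: "p \<in> D" for p \<alpha>
  proof -
    obtain e \<xi> where e: "\<And>\<alpha>. pdx (w \<alpha>) p = \<xi> \<alpha> *\<^sub>R e"
      using rank_one[OF p DU_columns(1)[OF p]] unfolding pdx_def by metis
    \<comment> \<open>The divisor \<open>\<xi> \<gamma>\<close> is nonzero because the immersion
      property makes \<open>pdx (w \<gamma>) p\<close> nonzero.\<close>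
    then have "pdx (w \<alpha>) p = (\<xi> \<alpha> / \<xi> \<gamma>) *\<^sub>R pdx (w \<gamma>) p" using ne[OF p] by auto
    then show ?thesis ..
  qed
  moreover have "\<exists>b. pdy (w \<alpha>) p = b *\<^sub>R pdy (w \<gamma>) p" if p: "p \<in> D" for p \<alpha>
  proof -
    obtain e \<xi> where e: "\<And>\<alpha>. pdy (w \<alpha>) p = \<xi> \<alpha> *\<^sub>R e"
      using rank_one[OF p DU_columns(2)[OF p]] unfolding pdy_def by metis
    then have "pdy (w \<alpha>) p = (\<xi> \<alpha> / \<xi> \<gamma>) *\<^sub>R pdy (w \<gamma>) p" using ne[OF p] by auto
    then show ?thesis ..
  qed
  ultimately show ?thesis
    using smooth(1) sw orth normal xy ne
    by (simp add: curvature_frame_def adapted_frame_def pdx_def pdy_def)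
qed

end

subsection \<open>The converse\<close>

context
  fixes T :: "real^'m^2" and B V :: "real^'m^'m"
  assumes AV: "(B + mat 1) ** V = mat 1" "V ** (B + mat 1) = mat 1"
    and TB: "transpose T ** T + transpose B ** B = mat 1"
begin

text \<open>Since \<open>V\<close> inverts \<open>B + mat 1\<close>, both products of
  \<open>B\<close> and \<open>V\<close> equal \<open>mat 1 - V\<close>. Together with the Gram
  relation this eliminates \<open>B\<close> next to \<open>V\<close>, and \<open>T\<close> next to
  its transpose.\<close>

private lemma expand:
  "B ** (V ** X) = X - V ** X" "V ** (B ** X) = X - V ** X"
  "transpose B ** (transpose V ** X) = X - transpose V ** X"
  "transpose V ** (transpose B ** X) = X - transpose V ** X"
  "transpose T ** (T ** X) = X - transpose B ** (B ** X)" for X :: "real^'k^'m"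
proof -
  have 1: "B ** V = mat 1 - V" "V ** B = mat 1 - V"
    using AV by (simp_all add: matrix_mult_expand algebra_simps)
  then have "transpose B ** transpose V = mat 1 - transpose V" "transpose V ** transpose B = mat 1 - transpose V"
    by (simp_all add: matrix_transpose_mul[symmetric] transpose_diff)
  with 1 show "B ** (V ** X) = X - V ** X" "V ** (B ** X) = X - V ** X"
    "transpose B ** (transpose V ** X) = X - transpose V ** X"
    "transpose V ** (transpose B ** X) = X - transpose V ** X"
    by (simp_all add: matrix_mul_assoc
        bounded_bilinear.diff_left[OF bounded_bilinear_matrix_mult])
  have "transpose T ** T = mat 1 - transpose B ** B" using TB by (simp add: algebra_simps)
  then show "transpose T ** (T ** X) = X - transpose B ** (B ** X)"
    by (simp add: matrix_mul_assoc bounded_bilinear.diff_left[OF bounded_bilinear_matrix_mult])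
qed

text \<open>Replacing \<open>transpose T ** T\<close> by \<open>mat 1 - transpose B ** B\<close> and
  \<open>B ** V\<close> by \<open>mat 1 - V\<close>, the terms quadratic in \<open>V\<close>
  cancel.\<close>

lemma cayley_relation: "V + transpose V = transpose (T ** V) ** (T ** V) + mat 1"
proof -
  have "B ** V = mat 1 - V" "transpose V ** transpose B = mat 1 - transpose V"
    using expand(1,4)[of "mat 1"] by simp_all
  then show ?thesis by (simp add: matrix_mult_expand expand)
qed

context
  fixes E :: "real^'m^2" and F :: "real^'m^'m"
  assumes EF: "transpose T ** E + transpose B ** F = 0"
begin

private lemma normal: "transpose T ** (E ** X) = - (transpose B ** (F ** X))" for X :: "real^'k^'m"
proof -
  have "transpose T ** E = - (transpose B ** F)" using EF by (simp add: eq_neg_iff_add_eq_0)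
  then show ?thesis
    by (simp add: matrix_mul_assoc bounded_bilinear.minus_left[OF bounded_bilinear_matrix_mult])
qed

text \<open>With \<open>E\<close> and \<open>F\<close> the derivatives of \<open>T\<close> and
  \<open>B\<close>, the left side is the derivative of \<open>V\<close> and the last factor on the
  right that of \<open>U = T ** V\<close>; the identity thus reads dV = U^t dU.\<close>

lemma cayley_derivative:
  "- (V ** F ** V) = transpose (T ** V) ** ((E - T ** V ** F) ** V)"
  by (simp add: matrix_mult_expand expand normal)

text \<open>The matrix \<open>E - T ** V ** F\<close> is the derivative of \<open>U\<close> times
  the inverse of \<open>V\<close>. Passing to it from the stacked derivatives preserves inner
  products, so orthogonality of the tangents reappears in the plane.\<close>

lemma cayley_gram:
  assumes EF': "transpose T ** E' + transpose B ** F' = 0"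
  shows "transpose (E - T ** V ** F) ** (E' - T ** V ** F') = transpose E ** E' + transpose F ** F'"
proof -
  have n: "transpose T ** E' = - (transpose B ** F')" using EF' by (simp add: eq_neg_iff_add_eq_0)
  have "transpose E ** T = - (transpose F ** B)"
  proof -
    have "transpose (transpose T ** E + transpose B ** F) = 0" unfolding EF by (simp add: transpose_def vec_eq_iff)
    then show ?thesis by (simp add: matrix_mult_expand eq_neg_iff_add_eq_0)
  qed
  then have n': "transpose E ** (T ** X) = - (transpose F ** (B ** X))" for X :: "real^'k^'m"
    by (simp add: matrix_mul_assoc bounded_bilinear.minus_left[OF bounded_bilinear_matrix_mult])
  show ?thesis by (simp add: matrix_mult_expand expand n n')
qed

end

end

lemma inner_vec_sum:
  fixes x y :: "real^('a::finite + 'b::finite)"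
  shows "x \<bullet> y = (\<Sum>a\<in>UNIV. x $ Inl a * y $ Inl a) + (\<Sum>b\<in>UNIV. x $ Inr b * y $ Inr b)"
  by (simp add: inner_vec_def UNIV_Plus_UNIV[symmetric] sum.Plus del: UNIV_Plus_UNIV)

lemma frechet_derivative_matrix:
  fixes f :: "'i::finite \<Rightarrow> 'j::finite \<Rightarrow> 'a::real_normed_vector \<Rightarrow> real"
  assumes "open S" "\<And>i j. smooth_on S (f i j)" "p \<in> S"
  shows "frechet_derivative (\<lambda>p. \<chi> i j. f i j p) (at p) v $ i $ j = frechet_derivative (f i j) (at p) v"
proof -
  have "bounded_linear (\<lambda>A. A $ i $ j)"
    by (rule bounded_linear_compose[OF bounded_linear_vec_nth bounded_linear_vec_nth])
  moreover have "smooth_on S (\<lambda>p. \<chi> i j. f i j p)" by (intro smooth_on_vec_lambda assms)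
  ultimately show ?thesis using assms(3) by (subst frechet_derivative_linear[symmetric]) auto
qed

lemma frechet_derivative_component:
  assumes "smooth_on S f" "p \<in> S"
  shows "frechet_derivative (\<lambda>q. f q $ i) (at p) v = frechet_derivative f (at p) v $ i"
  by (rule frechet_derivative_linear[OF bounded_linear_vec_nth assms])

lemma matrix_inv_matrix_inv:
  fixes A :: "real^'n^'n"
  assumes "invertible A"
  shows "matrix_inv (matrix_inv A) = A" "invertible (matrix_inv A)"
proof -
  show inv: "invertible (matrix_inv A)"
    using matrix_inv_mult[OF assms] unfolding invertible_def by blast
  have "A ** (matrix_inv A ** matrix_inv (matrix_inv A)) = A"
    using matrix_inv_mult(1)[OF inv] by simp
  then show "matrix_inv (matrix_inv A) = A"
    by (simp add: matrix_mul_assoc matrix_inv_mult[OF assms])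
qed

text \<open>Inverting the lower block plus the identity recovers \<open>V\<close>; the angle \<open>\<phi>\<close> is the direction of
  the derivative of the upper block corrected by \<open>U\<close> times that of the lower block.\<close>

lemma curvature_frame_reconstruct:
  fixes w :: "'m::finite \<Rightarrow> plane \<Rightarrow> real^(2 + 'm)"
  assumes frame: "curvature_frame N \<gamma> w" and q: "q \<in> N"
    and wq: "\<And>\<alpha>. w \<alpha> q = axis (Inr \<alpha>) 1"
    and xq: "pdx (w \<gamma>) q $ Inl 1 \<noteq> 0" "pdx (w \<gamma>) q $ Inl 2 \<noteq> 0"
  obtains D \<phi> \<kappa> s V where "q \<in> D" "D \<subseteq> N" "construction_data D \<phi> \<kappa> s V"
    "\<And>p \<alpha>. p \<in> D \<Longrightarrow> W_column (U_matrix \<kappa> s) V \<alpha> p = w \<alpha> p"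
proof -
  note sm = curvature_frame_smooth[OF frame]
  define T where "T p = (\<chi> a \<alpha>. w \<alpha> p $ Inl a)" for p
  define B where "B p = (\<chi> b \<alpha>. w \<alpha> p $ Inr b)" for p
  define V where "V p = matrix_inv (B p + mat 1)" for p
  define U where "U p = T p ** V p" for p
  let ?DT = "\<lambda>p v. frechet_derivative T (at p) v"
  let ?DB = "\<lambda>p v. frechet_derivative B (at p) v"
  \<comment> \<open>The derivative of \<open>U\<close> will be \<open>Y p v ** V p\<close>, and
    \<open>Y\<close> represents the derivative of the frame isometrically in the plane.\<close>
  define Y where "Y p v = ?DT p v - U p ** ?DB p v" for p v
  have sc: "smooth_on N (\<lambda>p. w \<alpha> p $ i)" for \<alpha> i by (intro smooth_on_component sm)
  have sT: "smooth_on N T" and sB: "smooth_on N B"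
    unfolding T_def[abs_def] B_def[abs_def] by (intro smooth_on_vec_lambda sm(1) sc)+
  have DT: "?DT p v $ a $ \<alpha> = frechet_derivative (w \<alpha>) (at p) v $ Inl a"
    and DB: "?DB p v $ b $ \<alpha> = frechet_derivative (w \<alpha>) (at p) v $ Inr b" if "p \<in> N" for p v a b \<alpha>
    unfolding T_def[abs_def] B_def[abs_def]
    by (simp_all add: frechet_derivative_matrix[OF sm(1) sc that] frechet_derivative_component[OF sm(2) that])
  have gram: "transpose (T p) ** T p + transpose (B p) ** B p = mat 1" if "p \<in> N" for p
    using curvature_frame_inner(1)[OF frame that]
    by (simp add: vec_eq_iff matrix_matrix_mult_def transpose_def T_def B_def mat_def inner_vec_sum)
  have normal: "transpose (T p) ** ?DT p v + transpose (B p) ** ?DB p v = 0" if "p \<in> N" for p v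
    using curvature_frame_inner_derivative[OF frame that]
    by (simp add: vec_eq_iff matrix_matrix_mult_def transpose_def T_def[of p] B_def[of p] DT[OF that] DB[OF that]
        inner_vec_sum)
  have sA: "smooth_on N (\<lambda>p. B p + mat 1)" by (intro smooth_on_add smooth_on_const sm sB)
  \<comment> \<open>At \<open>q\<close> the lower block is \<open>mat 1\<close>, so this determinant
    is a power of two there and stays nonzero nearby.\<close>
  define N1 where "N1 = N \<inter> (\<lambda>p. det (B p + mat 1)) -` (- {0})"
  have "smooth_on N (\<lambda>p. det (B p + mat 1))"
    by (intro smooth_on_det smooth_on_component sm(1) sA)
  then have oN1: "open N1" unfolding N1_def
    by (intro continuous_open_preimage smooth_on_continuous_on sm) auto
  have N1: "N1 \<subseteq> N" by (auto simp: N1_def)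
  have Tq: "T q = 0" and Bq: "B q = mat 1"
    by (simp_all add: T_def B_def wq vec_eq_iff axis_def mat_def)
  have "det (B q + mat 1) = 2 ^ CARD('m)"
    unfolding Bq by (subst det_diagonal) (auto simp: mat_def)
  then have q1: "q \<in> N1" using q by (simp add: N1_def)
  have inv: "invertible (B p + mat 1)" if "p \<in> N1" for p
    using that by (simp add: N1_def invertible_det_nz)
  have sV: "smooth_on N1 V" unfolding V_def[abs_def]
    by (rule smooth_on_matrix_inv[OF oN1 smooth_on_subset[OF sA N1] inv])
  have sU: "smooth_on N1 U" unfolding U_def[abs_def]
    by (rule smooth_on_matrix_mult[OF oN1 smooth_on_subset[OF sT N1] sV])
  have sY: "smooth_on N1 (\<lambda>p. Y p (1, 0) $ i $ \<gamma>)" for i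
    unfolding Y_def
    by (intro smooth_on_component smooth_on_diff smooth_on_matrix_mult smooth_on_frechet_derivative oN1 sU
        smooth_on_subset[OF sT N1] smooth_on_subset[OF sB N1])
  \<comment> \<open>At \<open>q\<close> the matrix \<open>U\<close> vanishes, so these entries of
    \<open>Y\<close> are the two plane components of \<open>pdx (w \<gamma>) q\<close>, nonzero by
    assumption. Near \<open>q\<close> they keep sine and cosine of the angle nonzero.\<close>
  define N2 where "N2 = N1 \<inter> (\<lambda>p. Y p (1, 0) $ 1 $ \<gamma> * Y p (1, 0) $ 2 $ \<gamma>) -` (- {0})"
  have "open N2" unfolding N2_def
    by (intro continuous_open_preimage smooth_on_continuous_on smooth_on_mult sY oN1) auto
  moreover have "q \<in> N2"
    using q1 xq by (simp add: N2_def Y_def U_def Tq DT[OF q] pdx_def)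
  ultimately obtain e where e: "e > 0" "ball q e \<subseteq> N2" using openE by blast
  \<comment> \<open>A ball is convex, hence simply connected as the construction requires.\<close>
  define D where "D = ball q e"
  have D1: "D \<subseteq> N1" and DN: "D \<subseteq> N" and qD: "q \<in> D" using e N1 by (auto simp: D_def N2_def)
  have Yne: "Y p (1, 0) $ 1 $ \<gamma> \<noteq> 0" "Y p (1, 0) $ 2 $ \<gamma> \<noteq> 0" if "p \<in> D" for p
    using e that by (auto simp: D_def N2_def)
  define \<kappa> where "\<kappa> \<alpha> p = U p $ 1 $ \<alpha>" for \<alpha> p
  define s where "s \<alpha> p = U p $ 2 $ \<alpha>" for \<alpha> p
  \<comment> \<open>Column \<open>\<gamma>\<close> and the first coordinate direction suffice to fix
    the angle: the other columns are parallel, and the second direction is perpendicular by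
    \<open>orth\<close>.\<close>
  define \<phi> where "\<phi> p = arctan (Y p (1, 0) $ 1 $ \<gamma> * inverse (Y p (1, 0) $ 2 $ \<gamma>))" for p
  have Ueq: "U_matrix \<kappa> s = U"
  proof
    fix p
    have "U_matrix \<kappa> s p $ i $ \<alpha> = U p $ i $ \<alpha>" for i \<alpha>
      using exhaust_2[of i] by (auto simp: U_matrix_def \<kappa>_def s_def)
    then show "U_matrix \<kappa> s p = U p" by (simp add: vec_eq_iff)
  qed
  have oD: "open D" by (simp add: D_def)
  have VA: "(B p + mat 1) ** V p = mat 1" "V p ** (B p + mat 1) = mat 1" if "p \<in> D" for p
    unfolding V_def by (rule matrix_inv_mult[OF inv[OF subsetD[OF D1 that]]])+
  have DV: "frechet_derivative V (at p) v = - (V p ** ?DB p v ** V p)" if "p \<in> D" for p v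
  proof -
    have pN: "p \<in> N1" "p \<in> N" using D1 N1 that by auto
    have "((\<lambda>p. B p + mat 1) has_derivative ?DB p) (at p)"
      using has_derivative_add[OF smooth_on_has_derivative[OF sB pN(2)] has_derivative_const[of "mat 1"]] by simp
    from has_derivative_matrix_inv[OF oN1 smooth_on_subset[OF sA N1] inv pN(1)] frechet_derivative_eqI[OF this]
    have "(V has_derivative (\<lambda>v. - (V p ** ?DB p v ** V p))) (at p)"
      unfolding V_def[abs_def] by simp
    from frechet_derivative_eqI[OF this] show ?thesis by simp
  qed
  have DU: "frechet_derivative U (at p) v = Y p v ** V p" if "p \<in> D" for p v
  proof -
    have "(U has_derivative (\<lambda>v. T p ** frechet_derivative V (at p) v + ?DT p v ** V p)) (at p)"
      unfolding U_def[abs_def] using that D1 N1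
      by (intro bounded_bilinear.FDERIV[OF bounded_bilinear_matrix_mult] smooth_on_has_derivative[OF sT]
          smooth_on_has_derivative[OF sV]) auto
    from frechet_derivative_eqI[OF this]
    have "frechet_derivative U (at p) v = T p ** frechet_derivative V (at p) v + ?DT p v ** V p" by simp
    then show ?thesis by (simp add: DV[OF that] Y_def U_def matrix_mult_expand)
  qed
  have dV: "frechet_derivative V (at p) v = transpose (U p) ** frechet_derivative U (at p) v"
    if "p \<in> D" for p v
    using cayley_derivative[OF VA[OF that] gram normal, of v] that DN
    unfolding DV[OF that] DU[OF that] Y_def U_def by blast
  have VV: "V p + transpose (V p) = transpose (U p) ** U p + mat 1" if "p \<in> D" for p
    using cayley_relation[OF VA[OF that] gram] that DN unfolding U_def by blast
  have orth: "Y p (1, 0) $ 1 $ \<gamma> * Y p (0, 1) $ 1 $ \<gamma> + Y p (1, 0) $ 2 $ \<gamma> * Y p (0, 1) $ 2 $ \<gamma> = 0"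
    if "p \<in> D" for p
  proof -
    have pN: "p \<in> N" using that DN by blast
    have "transpose (Y p (1, 0)) ** Y p (0, 1) =
        transpose (?DT p (1, 0)) ** ?DT p (0, 1) + transpose (?DB p (1, 0)) ** ?DB p (0, 1)"
      unfolding Y_def U_def using cayley_gram[OF VA[OF that] gram[OF pN] normal[OF pN] normal[OF pN]] .
    then have "(transpose (Y p (1, 0)) ** Y p (0, 1)) $ \<gamma> $ \<gamma> = pdx (w \<gamma>) p \<bullet> pdy (w \<gamma>) p"
      by (simp add: matrix_matrix_mult_def transpose_def DT[OF pN] DB[OF pN] inner_vec_sum pdx_def pdy_def)
    then show ?thesis
      using curvature_frame_inner(4)[OF frame pN] by (simp add: matrix_matrix_mult_def transpose_def sum_2)
  qed
  \<comment> \<open>Every column of \<open>Y p v\<close> is a multiple of its column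
    \<open>\<gamma>\<close>, and right multiplication by \<open>V p\<close> only recombines
    columns.\<close>
  have rank: "\<exists>\<xi>. \<forall>i. frechet_derivative U (at p) v $ i $ \<alpha> = Y p v $ i $ \<gamma> * \<xi>"
    if pD: "p \<in> D" and par: "\<And>\<beta>. \<exists>a. frechet_derivative (w \<beta>) (at p) v = a *\<^sub>R frechet_derivative (w \<gamma>) (at p) v"
    for p v \<alpha>
  proof -
    have pN: "p \<in> N" using pD DN by blast
    obtain a where a: "\<And>\<beta>. frechet_derivative (w \<beta>) (at p) v = a \<beta> *\<^sub>R frechet_derivative (w \<gamma>) (at p) v"
      using par by metis
    have Ya: "Y p v $ i $ \<beta> = Y p v $ i $ \<gamma> * a \<beta>" for i \<beta>
    proof -
      have "?DT p v $ i $ \<beta> = ?DT p v $ i $ \<gamma> * a \<beta>" "?DB p v $ j $ \<beta> = ?DB p v $ j $ \<gamma> * a \<beta>" for j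
        using a[of \<beta>] by (simp_all add: DT[OF pN] DB[OF pN])
      then show ?thesis
        by (simp add: Y_def matrix_matrix_mult_def left_diff_distrib sum_distrib_right mult.assoc)
    qed
    have "frechet_derivative U (at p) v $ i $ \<alpha> = Y p v $ i $ \<gamma> * (\<Sum>\<beta>\<in>UNIV. a \<beta> * V p $ \<beta> $ \<alpha>)" for i
    proof -
      have "frechet_derivative U (at p) v $ i $ \<alpha> = (\<Sum>\<beta>\<in>UNIV. Y p v $ i $ \<beta> * V p $ \<beta> $ \<alpha>)"
        by (simp add: DU[OF pD] matrix_matrix_mult_def)
      also have "\<dots> = (\<Sum>\<beta>\<in>UNIV. Y p v $ i $ \<gamma> * (a \<beta> * V p $ \<beta> $ \<alpha>))"
        by (intro sum.cong refl) (metis Ya mult.assoc)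
      finally show ?thesis by (simp add: sum_distrib_left)
    qed
    then show ?thesis by blast
  qed
  have sUD: "smooth_on D U" and sVD: "smooth_on D V" using sU sV D1 smooth_on_subset by blast+
  have s\<kappa>: "smooth_on D (\<kappa> \<alpha>)" "smooth_on D (s \<alpha>)" for \<alpha>
    unfolding \<kappa>_def[abs_def] s_def[abs_def] by (intro smooth_on_component oD sUD)+
  have s\<phi>: "smooth_on D \<phi>"
    unfolding \<phi>_def[abs_def]
    by (intro smooth_on_arctan smooth_on_mult smooth_on_inverse Yne oD smooth_on_subset[OF sY D1])
  have tan: "tan (\<phi> p) = Y p (1, 0) $ 1 $ \<gamma> / Y p (1, 0) $ 2 $ \<gamma>" for p
    by (simp add: \<phi>_def tan_arctan divide_inverse)
  have sincos: "sin (\<phi> p) * cos (\<phi> p) \<noteq> 0" if "p \<in> D" for p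
    using tan[of p] Yne[OF that] by (auto simp: tan_def)
  have cot: "cot (\<phi> p) = Y p (1, 0) $ 2 $ \<gamma> / Y p (1, 0) $ 1 $ \<gamma>" for p
    using tan[of p] by (metis cot_altdef inverse_divide)
  have D\<kappa>: "frechet_derivative (\<kappa> \<alpha>) (at p) v = frechet_derivative U (at p) v $ 1 $ \<alpha>"
    "frechet_derivative (s \<alpha>) (at p) v = frechet_derivative U (at p) v $ 2 $ \<alpha>" if "p \<in> D" for p v \<alpha>
    using frechet_derivative_U_matrix[of D \<kappa> s p, OF oD s\<kappa> that] by (simp_all add: Ueq)
  have proportional: "\<exists>a. pdx (w \<beta>) p = a *\<^sub>R pdx (w \<gamma>) p" "\<exists>b. pdy (w \<beta>) p = b *\<^sub>R pdy (w \<gamma>) p" if "p \<in> D" for p \<beta>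
    using curvature_frame_derivative[OF frame, of p \<beta>] that DN by blast+
  have ex: "pdx (\<kappa> \<alpha>) p = tan (\<phi> p) * pdx (s \<alpha>) p" if p: "p \<in> D" for \<alpha> p
  proof -
    obtain \<xi> where "\<And>i. frechet_derivative U (at p) (1, 0) $ i $ \<alpha> = Y p (1, 0) $ i $ \<gamma> * \<xi>"
      using rank[OF p proportional(1)[OF p, unfolded pdx_def]] by blast
    then show ?thesis using Yne[OF p] by (simp add: pdx_def D\<kappa>[OF p] tan)
  qed
  have ey: "pdy (\<kappa> \<alpha>) p = - cot (\<phi> p) * pdy (s \<alpha>) p" if p: "p \<in> D" for \<alpha> p
  proof -
    obtain \<xi> where \<xi>: "\<And>i. frechet_derivative U (at p) (0, 1) $ i $ \<alpha> = Y p (0, 1) $ i $ \<gamma> * \<xi>"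
      using rank[OF p proportional(2)[OF p, unfolded pdy_def]] by blast
    \<comment> \<open>Perpendicularity makes this ratio the negative reciprocal of the
      tangent.\<close>
    have "Y p (0, 1) $ 1 $ \<gamma> = - (Y p (1, 0) $ 2 $ \<gamma> / Y p (1, 0) $ 1 $ \<gamma>) * Y p (0, 1) $ 2 $ \<gamma>"
      using orth[OF p] Yne[OF p] by (simp add: field_simps add_eq_0_iff)
    then show ?thesis by (simp add: pdy_def D\<kappa>[OF p] cot \<xi>)
  qed
  have inv': "invertible (V p)" "matrix_inv (V p) = B p + mat 1" if "p \<in> D" for p
    unfolding V_def by (rule matrix_inv_matrix_inv[OF inv[OF subsetD[OF D1 that]]])+
  have "simply_connected D" by (simp add: D_def convex_imp_simply_connected)
  then have "construction_data D \<phi> \<kappa> s V"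
    unfolding construction_data_def Ueq
    by (intro conjI ballI allI oD s\<phi> sincos s\<kappa> ex ey sVD dV VV inv')
  moreover have "W_column (U_matrix \<kappa> s) V \<alpha> p = w \<alpha> p" if "p \<in> D" for p \<alpha>
  proof -
    \<comment> \<open>As \<open>matrix_inv (V p)\<close> is \<open>B p + mat 1\<close>, the matrix
      \<open>W\<close> has exactly the blocks \<open>T p\<close> and \<open>B p\<close>.\<close>
    have "U p ** (B p + mat 1) = T p" 
      using VA[OF that] by (simp add: U_def matrix_mul_assoc[symmetric])
    then have "W_column (U_matrix \<kappa> s) V \<alpha> p = column \<alpha> (stack (T p) (B p))"
      by (simp add: W_column_def W_matrix_stack Ueq inv'[OF that])
    also have "\<dots> = w \<alpha> p"
      by (simp add: vec_eq_iff column_def stack_def T_def B_def split: sum.splits)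
    finally show ?thesis .
  qed
  ultimately show thesis using that qD DN by blast
qed

section \<open>Frames from surfaces with flat normal bundle\<close>

lemma no_dxdy_term_mixed:
  assumes "smooth_on S f" "smooth_on S g" "p \<in> S" "no_dxdy_term (diff_form f g p)"
  shows "pdx f p \<bullet> pdy g p + pdy f p \<bullet> pdx g p = 0"
proof -
  obtain a b where Q: "\<And>dx dy. diff_form f g p (dx, dy) = a * dx\<^sup>2 + b * dy\<^sup>2"
    using assms(4) unfolding no_dxdy_term_def by blast
  \<comment> \<open>Polarisation: these three values isolate the coefficient of the mixed
    term.\<close>
  have "diff_form f g p (1, 1) - diff_form f g p (1, 0) - diff_form f g p (0, 1)
      = pdx f p \<bullet> pdy g p + pdy f p \<bullet> pdx g p"
    by (simp add: diff_form_def frechet_derivative_plane[OF assms(1,3)]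
        frechet_derivative_plane[OF assms(2,3)] inner_add_left inner_add_right)
  then show ?thesis by (simp add: Q)
qed

lemma parallel_normals_subset:
  assumes "parallel_normals D r I n" "D' \<subseteq> D"
  shows "parallel_normals D' r I n"
  using assms unfolding parallel_normals_def by (blast intro: smooth_on_subset)

text \<open>Equality of the mixed derivatives of \<open>r\<close> makes the two off-diagonal
  products of derivatives of \<open>n i\<close> and \<open>r\<close> equal, while the absent mixed
  term makes their sum zero. Both vanish, so each derivative of \<open>n i\<close>, being tangent,
  is a multiple of one coordinate tangent.\<close>

lemma parallel_normals_proportional:
  assumes N: "open N" "smooth_on N r" "immersion_on N r" and par: "parallel_normals N r I n"
    and i: "i \<in> I" and p: "p \<in> N"
    and rr: "\<And>p. p \<in> N \<Longrightarrow> no_dxdy_term (diff_form r r p)" and rn: "no_dxdy_term (diff_form r (n i) p)"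
  shows "\<exists>a. pdx (n i) p = a *\<^sub>R pdx r p" "\<exists>b. pdy (n i) p = b *\<^sub>R pdy r p"
proof -
  have n: "smooth_on N (n i)" using par i unfolding parallel_normals_def by blast
  have orth: "pdx r p \<bullet> pdy r p = 0" if "p \<in> N" for p
    using no_dxdy_term_mixed[OF N(2) N(2) that rr[OF that]] by (simp add: inner_commute)
  then have ne: "pdx r p \<noteq> 0" "pdy r p \<noteq> 0"
    using immersion_on_iff_independent[OF N(2) orth] N(3) p by auto
  have "pdy (pdx r) p = pdx (pdy r) p"
    unfolding pdx_def[abs_def] pdy_def[abs_def] by (rule mixed_derivatives_commute[OF N(1,2) p])
  then have "pdy (n i) p \<bullet> pdx r p = pdx (n i) p \<bullet> pdy r p"
    using parallel_normals_derivative(3,4)[OF par N(2,1) p i] by simp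
  then have xy: "pdx (n i) p \<bullet> pdy r p = 0" "pdy (n i) p \<bullet> pdx r p = 0"
    using no_dxdy_term_mixed[OF N(2) n p rn] by (auto simp: inner_commute)
  have "\<exists>a b. frechet_derivative (n i) (at p) v = a *\<^sub>R pdx r p + b *\<^sub>R pdy r p" for v
  proof -
    have "frechet_derivative (n i) (at p) v \<in> tangent_plane r p"
      using par i p unfolding parallel_normals_def by blast
    then show ?thesis
      unfolding tangent_plane_def using frechet_derivative_plane[OF N(2) p] by auto
  qed
  then obtain a b c d where
    ab: "pdx (n i) p = a *\<^sub>R pdx r p + b *\<^sub>R pdy r p" "pdy (n i) p = c *\<^sub>R pdx r p + d *\<^sub>R pdy r p"
    unfolding pdx_def pdy_def by meson
  then have "b = 0" "c = 0"
    using xy orth[OF p] ne by (auto simp: inner_add_left inner_add_right inner_commute)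
  with ab show "\<exists>a. pdx (n i) p = a *\<^sub>R pdx r p" "\<exists>b. pdy (n i) p = b *\<^sub>R pdy r p" by auto
qed

text \<open>The radius-vector takes place \<open>\<gamma>\<close> and the numbered normals fill the
  other indices. Unit length makes the radius-vector orthogonal to its own derivatives.\<close>

lemma curvature_frame_exists:
  fixes r :: "plane \<Rightarrow> real^(2 + 'm::finite)" and \<gamma> :: 'm
  assumes N: "open N" "smooth_on N r" "immersion_on N r" "r ` N \<subseteq> sphere 0 1"
    and par: "parallel_normals N r {..<DIM(real^(2 + 'm)) - 3} n"
    and rr: "\<And>p. p \<in> N \<Longrightarrow> no_dxdy_term (diff_form r r p)"
    and rn: "\<And>p i. \<lbrakk>p \<in> N; i < DIM(real^(2 + 'm)) - 3\<rbrakk> \<Longrightarrow> no_dxdy_term (diff_form r (n i) p)"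
  obtains w where "curvature_frame N \<gamma> w" "w \<gamma> = r"
proof -
  let ?I = "{..<DIM(real^(2 + 'm)) - 3}"
  have "card (UNIV - {\<gamma>}) = card ?I"
    by (simp add: card_Diff_singleton)
  then obtain \<sigma> where \<sigma>: "bij_betw \<sigma> (UNIV - {\<gamma>}) ?I"
    using finite_same_card_bij[of "UNIV - {\<gamma>}" ?I] by auto
  then have \<sigma>I: "\<sigma> \<alpha> \<in> ?I" if "\<alpha> \<noteq> \<gamma>" for \<alpha>
    using that unfolding bij_betw_def by blast
  have \<sigma>inj: "\<sigma> \<alpha> = \<sigma> \<beta> \<longleftrightarrow> \<alpha> = \<beta>" if "\<alpha> \<noteq> \<gamma>" "\<beta> \<noteq> \<gamma>" for \<alpha> \<beta>
    using \<sigma> that unfolding bij_betw_def inj_on_def by blast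
  define w where "w \<alpha> = (if \<alpha> = \<gamma> then r else n (\<sigma> \<alpha>))" for \<alpha>
  have n: "smooth_on N (n i)" if "i \<in> ?I" for i
    using par that unfolding parallel_normals_def by blast
  have nn: "n i p \<bullet> n j p = (if i = j then 1 else 0)" "n i p \<bullet> r p = 0" "r p \<bullet> n i p = 0"
    if "p \<in> N" "i \<in> ?I" "j \<in> ?I" for p i j
    using par that unfolding parallel_normals_def by (auto simp: inner_commute)
  have unit: "r p \<bullet> r p = 1" if "p \<in> N" for p
    using N(4) that by (auto simp: norm_eq_1[symmetric])
  have rv: "r p \<bullet> frechet_derivative r (at p) v = 0" if "p \<in> N" for p v
    using inner_constant_derivative[OF N(1,2,2) unit that, of v] by (simp add: inner_commute)
  have orth: "pdx r p \<bullet> pdy r p = 0" if "p \<in> N" for p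
    using no_dxdy_term_mixed[OF N(2) N(2) that rr[OF that]] by (simp add: inner_commute)
  have ne: "pdx r p \<noteq> 0" "pdy r p \<noteq> 0" if "p \<in> N" for p
    using immersion_on_iff_independent[OF N(2) orth] N(3) that by auto
  have "curvature_frame N \<gamma> w"
    unfolding curvature_frame_def
  proof (intro conjI allI ballI)
    show "open N" by fact
    show "smooth_on N (w \<alpha>)" for \<alpha> using N n \<sigma>I by (simp add: w_def)
    fix p assume p: "p \<in> N"
    have "w \<alpha> p \<bullet> w \<beta> p = (if \<alpha> = \<beta> then 1 else 0)" for \<alpha> \<beta>
      using nn[OF p \<sigma>I \<sigma>I, of \<alpha> \<beta>] nn(2)[OF p \<sigma>I \<sigma>I, of \<alpha> \<alpha>]
        nn(3)[OF p \<sigma>I \<sigma>I, of \<beta> \<beta>] unit[OF p] \<sigma>inj[of \<alpha> \<beta>]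
      by (auto simp: w_def)
    moreover have "w \<alpha> p \<bullet> pdx r p = 0 \<and> w \<alpha> p \<bullet> pdy r p = 0" for \<alpha>
      using parallel_normals_derivative(1,2)[OF par N(2,1) p \<sigma>I] rv[OF p]
      by (auto simp: w_def pdx_def pdy_def)
    ultimately show "adapted_frame (pdx (w \<gamma>) p) (pdy (w \<gamma>) p) (\<lambda>\<alpha>. w \<alpha> p)"
      using orth[OF p] ne[OF p] by (simp add: adapted_frame_def w_def[of \<gamma>])
    fix \<alpha>
    show "\<exists>a. pdx (w \<alpha>) p = a *\<^sub>R pdx (w \<gamma>) p"
    proof (cases "\<alpha> = \<gamma>")
      case True
      then show ?thesis by (intro exI[of _ 1]) simp
    next
      case False
      with parallel_normals_proportional(1)[OF N(1-3) par \<sigma>I p rr rn[OF p]] \<sigma>I[OF False]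
      show ?thesis by (simp add: w_def)
    qed
    show "\<exists>b. pdy (w \<alpha>) p = b *\<^sub>R pdy (w \<gamma>) p"
    proof (cases "\<alpha> = \<gamma>")
      case True
      then show ?thesis by (intro exI[of _ 1]) simp
    next
      case False
      with parallel_normals_proportional(2)[OF N(1-3) par \<sigma>I p rr rn[OF p]] \<sigma>I[OF False]
      show ?thesis by (simp add: w_def)
    qed
  qed
  then show thesis using that by (simp add: w_def)
qed

text \<open>A linear isometry commutes with differentiation and preserves every inner product in the
  definition.\<close>

lemma curvature_frame_orthogonal_transformation:
  fixes w :: "'m::finite \<Rightarrow> plane \<Rightarrow> real^(2 + 'm)"
  assumes frame: "curvature_frame D \<gamma> w" and T: "orthogonal_transformation T"
  shows "curvature_frame D \<gamma> (\<lambda>\<alpha>. T \<circ> w \<alpha>)"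
    "p \<in> D \<Longrightarrow> pdx (T \<circ> w \<gamma>) p = T (pdx (w \<gamma>) p)"
proof -
  have lin: "linear T" and inner: "T u \<bullet> T v = u \<bullet> v" for u v
    using T by (auto simp: orthogonal_transformation_def)
  have bl: "bounded_linear T" using lin by (simp add: linear_conv_bounded_linear)
  have smooth: "smooth_on D (T \<circ> w \<alpha>)" for \<alpha>
    using smooth_on_linear[OF curvature_frame_smooth(1)[OF frame] bl curvature_frame_smooth(2)[OF frame]]
    by (simp add: o_def)
  have D: "pdx (T \<circ> w \<alpha>) p = T (pdx (w \<alpha>) p)" "pdy (T \<circ> w \<alpha>) p = T (pdy (w \<alpha>) p)" if "p \<in> D" for \<alpha> p
    using frechet_derivative_linear[OF bl curvature_frame_smooth(2)[OF frame] that]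
    by (simp_all add: pdx_def pdy_def o_def)
  have zero: "T u = 0 \<longleftrightarrow> u = 0" for u
    using inner[of u u] by (metis inner_eq_zero_iff)
  show "curvature_frame D \<gamma> (\<lambda>\<alpha>. T \<circ> w \<alpha>)"
    using frame D smooth unfolding curvature_frame_def adapted_frame_def
    by (simp add: inner zero) (metis linear_cmul[OF lin])
  show "p \<in> D \<Longrightarrow> pdx (T \<circ> w \<gamma>) p = T (pdx (w \<gamma>) p)" using D by blast
qed

text \<open>The columns of the constructed \<open>W\<close> are known to agree with the rotated
  frame only on \<open>D\<^sub>0\<close>; openness lets the derivatives agree as well.\<close>

lemma parallel_normals_cong:
  assumes "open D" "\<And>p i. \<lbrakk>p \<in> D; i \<in> I\<rbrakk> \<Longrightarrow> n i p = n' i p" "parallel_normals D r I n"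
  shows "parallel_normals D r I n'"
proof -
  have n: "smooth_on D (n i)" if "i \<in> I" for i
    using assms(3) that unfolding parallel_normals_def by blast
  have "smooth_on D (n' i)" if "i \<in> I" for i
    by (rule smooth_on_cong[OF assms(1) assms(2)[OF _ that] n[OF that]])
  moreover have "frechet_derivative (n' i) (at p) = frechet_derivative (n i) (at p)" if "p \<in> D" "i \<in> I" for p i
  proof -
    have "(n i has_derivative frechet_derivative (n i) (at p)) (at p)"
      by (rule smooth_on_has_derivative[OF n[OF that(2)] that(1)])
    from has_derivative_transform_within_open[OF this assms(1) that(1) assms(2)[OF _ that(2)]]
    show ?thesis by (rule frechet_derivative_eqI)
  qed
  ultimately show ?thesis
    using assms(2,3) unfolding parallel_normals_def by simp
qed

text \<open>A homeomorphism is open onto its image, and relative openness is transitive.\<close>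

lemma local_parametrization_subset:
  assumes "local_parametrization M D r" "open D'" "D' \<subseteq> D"
  shows "local_parametrization M D' r"
proof -
  obtain g where g: "homeomorphism D (r ` D) r g"
    using assms(1) unfolding local_parametrization_def by blast
  have "openin (top_of_set D) D'" using assms by (metis inf.absorb_iff2 openin_open)
  from homeomorphism_imp_open_map[OF g this] have "openin (top_of_set M) (r ` D')"
    using assms(1) openin_trans unfolding local_parametrization_def by blast
  moreover have "homeomorphism D' (r ` D') r g"
    using homeomorphism_of_subsets[OF g assms(3) order_refl refl] .
  ultimately show ?thesis
    using assms smooth_on_subset unfolding local_parametrization_def immersion_on_def by blast
qed

theorem theorem1:
  shows
    "(\<forall>D \<phi> (\<kappa> :: 'm::finite \<Rightarrow> plane \<Rightarrow> real) s V.
        construction_data D \<phi> \<kappa> s V \<longrightarrow>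
        (let U = U_matrix \<kappa> s; W = W_matrix U V; w = W_column U V;
             Q = (\<lambda>p v. matrix_inv (transpose (V p)) ** transpose (frechet_derivative U (at p) v)
                      ** frechet_derivative U (at p) v ** matrix_inv (V p))
         in (\<forall>p\<in>D. \<forall>v. transpose (frechet_derivative W (at p) v) ** frechet_derivative W (at p) v
                = Q p v) \<and>
            (\<forall>\<gamma>. immersion_on D (w \<gamma>) \<longrightarrow>
               surface_in_sphere D (w \<gamma>) \<and>
               has_flat_normal_bundle D (w \<gamma>) \<and>
               curvature_line_coordinates D (w \<gamma>) \<and>
               parallel_normals D (w \<gamma>) (UNIV - {\<gamma>}) w \<and>
               (\<forall>p\<in>D. \<forall>v. diff_form (w \<gamma>) (w \<gamma>) p v = Q p v $ \<gamma> $ \<gamma>) \<and>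
               (\<forall>\<alpha>. \<alpha> \<noteq> \<gamma> \<longrightarrow>
                  (\<forall>p\<in>D. \<forall>v. diff_form (w \<gamma>) (w \<alpha>) p v = Q p v $ \<gamma> $ \<alpha>)))))
   \<and>
     (\<forall>(M :: (real^(2 + 'm)) set) p\<^sub>0 D r.
        smooth_surface M \<and> M \<subseteq> sphere 0 1 \<and> flat_normal_bundle M \<and>
        local_parametrization M D r \<and> p\<^sub>0 \<in> r ` D \<and> curvature_line_coordinates D r \<longrightarrow>
        (\<exists>D\<^sub>0 T \<phi> (\<kappa> :: 'm \<Rightarrow> plane \<Rightarrow> real) s V \<gamma>.
           D\<^sub>0 \<subseteq> D \<and> local_parametrization M D\<^sub>0 r \<and> p\<^sub>0 \<in> r ` D\<^sub>0 \<and>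
           orthogonal_transformation T \<and>
           construction_data D\<^sub>0 \<phi> \<kappa> s V \<and>
           (\<forall>p\<in>D\<^sub>0. T (r p) = W_column (U_matrix \<kappa> s) V \<gamma> p) \<and>
           parallel_normals D\<^sub>0 (T \<circ> r) (UNIV - {\<gamma>}) (W_column (U_matrix \<kappa> s) V)))"
proof (rule conjI, goal_cases)
  case 1
  show ?case
    unfolding Let_def
    by (intro allI impI conjI ballI derivative_W_gram diff_form_W_column curvature_frame_surface
        curvature_frame_flat curvature_frame_coordinates curvature_frame_parallel_normals
        W_column_curvature_frame)
next
  case 2
  show ?case
  proof (intro allI impI, elim conjE)
    fix M :: "(real^(2 + 'm)) set" and p\<^sub>0 D r
    assume M: "M \<subseteq> sphere 0 1" and flat: "flat_normal_bundle M" and r: "local_parametrization M D r"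
      and p\<^sub>0: "p\<^sub>0 \<in> r ` D" and curv: "curvature_line_coordinates D r"
    obtain q where q: "q \<in> D" "r q = p\<^sub>0" using p\<^sub>0 by blast
    have "has_flat_normal_bundle D r" using flat r unfolding flat_normal_bundle_def by blast
    then obtain N n where N: "open N" "q \<in> N" "N \<subseteq> D"
      and par: "parallel_normals N r {..<DIM(real^(2 + 'm)) - 3} n"
      using q unfolding has_flat_normal_bundle_def by blast
    have rN: "smooth_on N r" "immersion_on N r" "r ` N \<subseteq> sphere 0 1"
      using local_parametrization_subset[OF r N(1,3)] M openin_imp_subset
      unfolding local_parametrization_def by blast+
    have rr: "no_dxdy_term (diff_form r r p)"
      and rn: "i < DIM(real^(2 + 'm)) - 3 \<Longrightarrow> no_dxdy_term (diff_form r (n i) p)" if "p \<in> N" for p i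
      using curv N par that unfolding curvature_line_coordinates_def by blast+
    \<comment> \<open>Any column may carry the radius-vector, so an arbitrary index is
      fixed.\<close>
    define \<gamma> :: 'm where "\<gamma> = undefined"
    obtain w where w: "curvature_frame N \<gamma> w" "w \<gamma> = r"
      using curvature_frame_exists[OF N(1) rN par rr rn] by blast
    have "adapted_frame (pdx (w \<gamma>) q) (pdy (w \<gamma>) q) (\<lambda>\<alpha>. w \<alpha> q)"
      using w(1) N(2) unfolding curvature_frame_def by blast
    \<comment> \<open>This is the choice of orthonormal coordinates, dictated by the frame at the
      single point \<open>q\<close>.\<close>
    then obtain T :: "real^(2 + 'm) \<Rightarrow> real^(2 + 'm)" where T: "orthogonal_transformation T"
      "\<And>\<alpha>. T (w \<alpha> q) = axis (Inr \<alpha>) 1" "T (pdx (w \<gamma>) q) $ Inl 1 \<noteq> 0" "T (pdx (w \<gamma>) q) $ Inl 2 \<noteq> 0"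
      by (rule adapted_frame_straighten) (rule that)
    note Tw = curvature_frame_orthogonal_transformation[OF w(1) T(1)]
    have Tq: "(T \<circ> w \<alpha>) q = axis (Inr \<alpha>) 1"
      "pdx (T \<circ> w \<gamma>) q $ Inl 1 \<noteq> 0" "pdx (T \<circ> w \<gamma>) q $ Inl 2 \<noteq> 0" for \<alpha>
      using T Tw(2)[OF N(2)] by simp_all
    obtain D\<^sub>0 \<phi> \<kappa> s V where D\<^sub>0: "q \<in> D\<^sub>0" "D\<^sub>0 \<subseteq> N" "construction_data D\<^sub>0 \<phi> \<kappa> s V"
      "\<And>p \<alpha>. p \<in> D\<^sub>0 \<Longrightarrow> W_column (U_matrix \<kappa> s) V \<alpha> p = (T \<circ> w \<alpha>) p"
      by (rule curvature_frame_reconstruct[OF Tw(1) N(2) Tq]) (rule that)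
    have "open D\<^sub>0" using D\<^sub>0(3) by (simp add: construction_data_def)
    have Tn: "parallel_normals D\<^sub>0 (T \<circ> r) (UNIV - {\<gamma>}) (\<lambda>\<alpha>. T \<circ> w \<alpha>)"
      using parallel_normals_subset[OF curvature_frame_parallel_normals[OF Tw(1)] D\<^sub>0(2)] w(2) by simp
    have "parallel_normals D\<^sub>0 (T \<circ> r) (UNIV - {\<gamma>}) (W_column (U_matrix \<kappa> s) V)"
      by (rule parallel_normals_cong[OF \<open>open D\<^sub>0\<close> _ Tn]) (simp add: D\<^sub>0(4))
    moreover note \<open>open D\<^sub>0\<close>
    moreover have "D\<^sub>0 \<subseteq> D" using D\<^sub>0 N by blast
    moreover have "\<forall>p\<in>D\<^sub>0. T (r p) = W_column (U_matrix \<kappa> s) V \<gamma> p" using D\<^sub>0(4) w(2) by simp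
    ultimately show "\<exists>D\<^sub>0 T \<phi> (\<kappa> :: 'm \<Rightarrow> plane \<Rightarrow> real) s V \<gamma>.
           D\<^sub>0 \<subseteq> D \<and> local_parametrization M D\<^sub>0 r \<and> p\<^sub>0 \<in> r ` D\<^sub>0 \<and>
           orthogonal_transformation T \<and>
           construction_data D\<^sub>0 \<phi> \<kappa> s V \<and>
           (\<forall>p\<in>D\<^sub>0. T (r p) = W_column (U_matrix \<kappa> s) V \<gamma> p) \<and>
           parallel_normals D\<^sub>0 (T \<circ> r) (UNIV - {\<gamma>}) (W_column (U_matrix \<kappa> s) V)"
      using T(1) D\<^sub>0(1,3) q(2) local_parametrization_subset[OF r] by blast
  qed
qed

end
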